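(* Let $K$ be a field and let $\mathcal P$ be a finite poset with incidence algebra $I(\mathcal P)$ over $K$. Then the single-source homological spread invariant is finer than the rank invariant on $\mathrm{mod}\,I(\mathcal P)$. Moreover, these invariants are equivalent if and only if for all $a\in\mathcal P$ the subposet $\{x\in\mathcal P\mid a\le x\}$ is totally ordered.
   Context: $\mathrm{mod}\,I(\mathcal P)$ is the category of finitely generated (right) $I(\mathcal P)$-modules, identified with functors $M$ from $\mathcal P$ (viewed as a category) to finite-dimensional $K$-vector spaces; $M(a)$ is the value at $a$ and $M(a,b):M(a)\to M(b)$ is the map for $a\le b$. A single-source spread is a set $[a,B]=\{x\mid a\le x\le b\text{ for some }b\in B\}$, where $a\in\mathcal P$ and $B\subseteq\mathcal P$ is a nonempty set of pairwise incomparable elements with $a\le b$ for all $b\in B$. The single-source spread module $M_{[a,B]}$ has value $K$ on points of $[a,B]$ and $0$ elsewhere, with identity maps between points of $[a,B]$ and zero maps otherwise. $K_0^{split}(I(\mathcal P))$ is the free abelian group on isomorphism classes $[M]$ of modules modulo $[M\oplus N]=[M]+[N]$. An invariant is a surjective group homomorphism from it to some $\mathbb Z^n$. An invariant $p$ is finer than an invariant $q$ if $\ker p\subseteq\ker q$; $p$ and $q$ are equivalent if $\ker p=\ker q$. For a finite set $\mathcal X$ of indecomposable modules containing the indecomposable projectives, $\mathcal E_{\mathcal X}$ is the class of short exact sequences $0\to M\to N\xrightarrow{g}L\to0$ in $\mathrm{mod}\,I(\mathcal P)$ such that $\operatorname{Hom}(R,g)$ is surjective for all $R\in\mathcal X$,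 and $K_0(I(\mathcal P),\mathcal X)$ is the free abelian group on isomorphism classes of modules modulo the subgroup generated by all $[M]-[N]+[L]$ for sequences in $\mathcal E_{\mathcal X}$. The single-source homological spread invariant is the quotient map $K_0^{split}(I(\mathcal P))\to K_0(I(\mathcal P),\mathcal X)\simeq\mathbb Z^{|\mathcal X|}$, where $\mathcal X$ is the set of all single-source spread modules. The rank invariant is the map $K_0^{split}(I(\mathcal P))\to\mathbb Z^{\{(a,b)\mid a\le b\in\mathcal P\}}$ given by $[M]\mapsto(\operatorname{rk}M(a,b))_{a\le b\in\mathcal P}$. *)

theory Defs
  imports
    Complex_Main
    "HOL-Library.Function_Algebras"
    "HOL-Library.Nat_Bijection"
    "HOL-Algebra.Free_Abelian_Groups"
begin

section \<open>Finite-dimensional vector spaces\<close>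

text \<open>
  HOL has no type of all vector spaces. We take as objects, over the field \<open>'k\<close>,
  the finite-dimensional subspaces of the infinite-dimensional space \<open>nat \<Rightarrow> 'k\<close>, with all
  \<open>'k\<close>-linear maps between them; every finite-dimensional \<open>'k\<close>-vector space is isomorphic to one of
  these.
\<close>

definition vscale :: "'k::field \<Rightarrow> (nat \<Rightarrow> 'k) \<Rightarrow> (nat \<Rightarrow> 'k)" where
  "vscale c v = (\<lambda>i. c * v i)"

interpretation KN: vector_space "vscale :: 'k::field \<Rightarrow> (nat \<Rightarrow> 'k) \<Rightarrow> (nat \<Rightarrow> 'k)"
  by unfold_locales (auto simp: vscale_def fun_eq_iff algebra_simps)

definition fd_space :: "(nat \<Rightarrow> 'k::field) set \<Rightarrow> bool" where
  "fd_space V \<longleftrightarrow> (\<exists>B. finite B \<and> V = KN.span B)"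

text \<open>Maps are only meaningful on their domain \<open>V\<close>; values outside \<open>V\<close> are ignored throughout.\<close>

definition linear_map :: "(nat \<Rightarrow> 'k::field) set \<Rightarrow> (nat \<Rightarrow> 'k) set \<Rightarrow> ((nat \<Rightarrow> 'k) \<Rightarrow> (nat \<Rightarrow> 'k)) \<Rightarrow> bool"
  where
  "linear_map V W f \<longleftrightarrow>
     (\<forall>v\<in>V. f v \<in> W) \<and>
     (\<forall>u\<in>V. \<forall>v\<in>V. f (u + v) = f u + f v) \<and>
     (\<forall>c. \<forall>v\<in>V. f (vscale c v) = vscale c (f v))"

section \<open>Modules over the incidence algebra\<close>

record ('p, 'k) pmod =
  vspace :: "'p \<Rightarrow> (nat \<Rightarrow> 'k) set"
  trans_map :: "'p \<Rightarrow> 'p \<Rightarrow> (nat \<Rightarrow> 'k) \<Rightarrow> (nat \<Rightarrow> 'k)"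

definition is_module :: "('p::{finite,order}, 'k::field) pmod \<Rightarrow> bool" where
  "is_module M \<longleftrightarrow>
     (\<forall>a. fd_space (vspace M a)) \<and>
     (\<forall>a b. a \<le> b \<longrightarrow> linear_map (vspace M a) (vspace M b) (trans_map M a b)) \<and>
     (\<forall>a. \<forall>v\<in>vspace M a. trans_map M a a v = v) \<and>
     (\<forall>a b c. a \<le> b \<longrightarrow> b \<le> c \<longrightarrow>
        (\<forall>v\<in>vspace M a. trans_map M b c (trans_map M a b v) = trans_map M a c v))"

type_synonym ('p, 'k) pmap = "'p \<Rightarrow> (nat \<Rightarrow> 'k) \<Rightarrow> (nat \<Rightarrow> 'k)"

definition pmod_hom ::
  "('p::{finite,order}, 'k::field) pmod \<Rightarrow> ('p, 'k) pmod \<Rightarrow> ('p, 'k) pmap \<Rightarrow> bool" where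
  "pmod_hom M N f \<longleftrightarrow>
     (\<forall>a. linear_map (vspace M a) (vspace N a) (f a)) \<and>
     (\<forall>a b. a \<le> b \<longrightarrow>
        (\<forall>v\<in>vspace M a. f b (trans_map M a b v) = trans_map N a b (f a v)))"

definition pmod_iso :: "('p::{finite,order}, 'k::field) pmod \<Rightarrow> ('p, 'k) pmod \<Rightarrow> bool" where
  "pmod_iso M N \<longleftrightarrow>
     (\<exists>f. pmod_hom M N f \<and> (\<forall>a. bij_betw (f a) (vspace M a) (vspace N a)))"

definition iso_class :: "('p::{finite,order}, 'k::field) pmod \<Rightarrow> ('p, 'k) pmod set" where
  "iso_class M = {N. is_module N \<and> pmod_iso M N}"

definition iso_classes :: "('p::{finite,order}, 'k::field) pmod set set" where
  "iso_classes = iso_class ` {M. is_module M}"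

text \<open>The summands are placed in two disjoint, jointly exhaustive sets of coordinates of
  \<open>nat \<Rightarrow> 'k\<close>, using the bijection \<open>sum_encode\<close> from \<open>nat + nat\<close> to \<open>nat\<close>.\<close>

definition vjoin :: "(nat \<Rightarrow> 'k) \<Rightarrow> (nat \<Rightarrow> 'k) \<Rightarrow> (nat \<Rightarrow> 'k)" where
  "vjoin u v = (\<lambda>n. case_sum u v (sum_decode n))"

definition left_part :: "(nat \<Rightarrow> 'k) \<Rightarrow> (nat \<Rightarrow> 'k)" where
  "left_part w = (\<lambda>i. w (sum_encode (Inl i)))"

definition right_part :: "(nat \<Rightarrow> 'k) \<Rightarrow> (nat \<Rightarrow> 'k)" where
  "right_part w = (\<lambda>i. w (sum_encode (Inr i)))"

definition direct_sum ::
  "('p::{finite,order}, 'k::field) pmod \<Rightarrow> ('p, 'k) pmod \<Rightarrow> ('p, 'k) pmod" where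
  "direct_sum M N =
     \<lparr> vspace = (\<lambda>a. {vjoin u v | u v. u \<in> vspace M a \<and> v \<in> vspace N a}),
       trans_map = (\<lambda>a b w. vjoin (trans_map M a b (left_part w)) (trans_map N a b (right_part w))) \<rparr>"

definition short_exact ::
  "('p::{finite,order}, 'k::field) pmod \<Rightarrow> ('p, 'k) pmap \<Rightarrow> ('p, 'k) pmod \<Rightarrow> ('p, 'k) pmap \<Rightarrow>
   ('p, 'k) pmod \<Rightarrow> bool" where
  "short_exact M f N g L \<longleftrightarrow>
     is_module M \<and> is_module N \<and> is_module L \<and> pmod_hom M N f \<and> pmod_hom N L g \<and>
     (\<forall>a. inj_on (f a) (vspace M a) \<and>
          f a ` vspace M a = {v \<in> vspace N a. g a v = 0} \<and>
          g a ` vspace N a = vspace L a)"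

definition Hom_surjective ::
  "('p::{finite,order}, 'k::field) pmod \<Rightarrow> ('p, 'k) pmod \<Rightarrow> ('p, 'k) pmap \<Rightarrow> ('p, 'k) pmod \<Rightarrow> bool"
  where
  "Hom_surjective R N g L \<longleftrightarrow>
     (\<forall>h. pmod_hom R L h \<longrightarrow>
        (\<exists>h'. pmod_hom R N h' \<and> (\<forall>a. \<forall>v\<in>vspace R a. g a (h' a v) = h a v)))"

section \<open>Single-source spread modules\<close>

definition single_source_pair :: "'p::{finite,order} \<Rightarrow> 'p set \<Rightarrow> bool" where
  "single_source_pair a B \<longleftrightarrow>
     B \<noteq> {} \<and> (\<forall>b\<in>B. \<forall>b'\<in>B. b \<le> b' \<longrightarrow> b = b') \<and> (\<forall>b\<in>B. a \<le> b)"

definition spread :: "'p::{finite,order} \<Rightarrow> 'p set \<Rightarrow> 'p set" where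
  "spread a B = {x. a \<le> x \<and> (\<exists>b\<in>B. x \<le> b)}"

text \<open>The one-dimensional space \<open>'k\<close> is realised as the line of the \<open>0\<close>-th coordinate.\<close>

definition spread_module :: "'p::{finite,order} \<Rightarrow> 'p set \<Rightarrow> ('p, 'k::field) pmod" where
  "spread_module a B =
     \<lparr> vspace = (\<lambda>x. if x \<in> spread a B then {v. \<forall>i>0. v i = 0} else {0}),
       trans_map = (\<lambda>x y v. if x \<in> spread a B \<and> y \<in> spread a B then v else 0) \<rparr>"

definition single_source_spread_modules :: "('p::{finite,order}, 'k::field) pmod set" where
  "single_source_spread_modules = {spread_module a B | a B. single_source_pair a B}"

section \<open>Grothendieck groups\<close>

type_synonym ('p, 'k) free_elem = "('p, 'k) pmod set \<Rightarrow>\<^sub>0 int"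

text \<open>Elements of a quotient of the free abelian group are cosets.\<close>

type_synonym ('p, 'k) K0_elem = "('p, 'k) free_elem set"

abbreviation free_on_classes :: "('p::{finite,order}, 'k::field) free_elem monoid" where
  "free_on_classes \<equiv> free_Abelian_group iso_classes"

definition split_relations :: "('p::{finite,order}, 'k::field) free_elem set" where
  "split_relations = generate free_on_classes
     {frag_of (iso_class (direct_sum M N)) - (frag_of (iso_class M) + frag_of (iso_class N))
        | M N. is_module M \<and> is_module N}"

definition K0_split :: "('p::{finite,order}, 'k::field) K0_elem monoid" where
  "K0_split = free_on_classes Mod split_relations"

definition exact_relations ::
  "('p::{finite,order}, 'k::field) pmod set \<Rightarrow> ('p, 'k) free_elem set" where
  "exact_relations X = generate free_on_classes
     {frag_of (iso_class M) - frag_of (iso_class N) + frag_of (iso_class L)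
        | M f N g L. short_exact M f N g L \<and> (\<forall>R\<in>X. Hom_surjective R N g L)}"

definition K0_rel ::
  "('p::{finite,order}, 'k::field) pmod set \<Rightarrow> ('p, 'k) K0_elem monoid" where
  "K0_rel X = free_on_classes Mod exact_relations X"

section \<open>Invariants\<close>

text \<open>Maps out of \<open>K0_split\<close> are given by maps out of the free abelian group that are constant
  on the cosets of \<open>split_relations\<close>, as in \<open>FactGroup_hom\<close>.\<close>

definition induced :: "('a \<Rightarrow> 'b) \<Rightarrow> 'a set \<Rightarrow> 'b" where
  "induced h U = the_elem (h ` U)"

definition ss_homological_spread_invariant ::
  "('p::{finite,order}, 'k::field) K0_elem \<Rightarrow> ('p, 'k) K0_elem" where
  "ss_homological_spread_invariant =
     induced (\<lambda>u. exact_relations single_source_spread_modules #>\<^bsub>free_on_classes\<^esub> u)"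

definition module_rank :: "('p::{finite,order}, 'k::field) pmod \<Rightarrow> 'p \<Rightarrow> 'p \<Rightarrow> nat" where
  "module_rank M a b = KN.dim (trans_map M a b ` vspace M a)"

definition rank_target :: "('p::{finite,order} \<times> 'p \<Rightarrow> int) monoid" where
  "rank_target = product_group {(a, b). a \<le> b} (\<lambda>_. integer_group)"

definition rank_on_free ::
  "('p::{finite,order}, 'k::field) free_elem \<Rightarrow> 'p \<times> 'p \<Rightarrow> int" where
  "rank_on_free u = (\<lambda>(a, b)\<in>{(a, b). a \<le> b}.
     \<Sum>C\<in>Poly_Mapping.keys u. Poly_Mapping.lookup u C * int (induced (\<lambda>M. module_rank M a b) C))"

definition rank_invariant ::
  "('p::{finite,order}, 'k::field) K0_elem \<Rightarrow> 'p \<times> 'p \<Rightarrow> int" where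
  "rank_invariant = induced rank_on_free"

definition finer ::
  "('g, 'm) monoid_scheme \<Rightarrow> ('h, 'n) monoid_scheme \<Rightarrow> ('g \<Rightarrow> 'h) \<Rightarrow>
   ('l, 'o) monoid_scheme \<Rightarrow> ('g \<Rightarrow> 'l) \<Rightarrow> bool" where
  "finer G H p L q \<longleftrightarrow> kernel G H p \<subseteq> kernel G L q"

definition equivalent ::
  "('g, 'm) monoid_scheme \<Rightarrow> ('h, 'n) monoid_scheme \<Rightarrow> ('g \<Rightarrow> 'h) \<Rightarrow>
   ('l, 'o) monoid_scheme \<Rightarrow> ('g \<Rightarrow> 'l) \<Rightarrow> bool" where
  "equivalent G H p L q \<longleftrightarrow> kernel G H p = kernel G L q"

end

theory Submission
  imports Defs
begin

text \<open>
  Let \<open>G\<close> be the free abelian group on the isomorphism classes, \<open>S\<close> the subgroup of split relations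
  and \<open>E\<close> the subgroup of relations of the exact structure given by the single-source spread modules.
  Split sequences are exact for this structure, so \<open>S \<subseteq> E\<close>, and both invariants are induced by maps
  on \<open>G\<close>: their kernels are \<open>E/S\<close> and \<open>R/S\<close>, where \<open>R\<close> consists of the elements all of whose ranks
  vanish (\<open>rank_null\<close>). The theorem therefore says that \<open>E \<subseteq> R\<close>, with equality if and only if every
  principal up-set is a chain.

  \<^emph>\<open>The inclusion.\<close> A homomorphism from the spread module of \<open>[a,B]\<close> to \<open>M\<close> is the same as a vector
  of \<open>M(a)\<close> that is killed by \<open>M(a,y)\<close> for all \<open>y\<close> above \<open>a\<close> outside \<open>[a,B]\<close>. The complements of the
  spreads with source \<open>a\<close> are exactly the up-closed sets \<open>T\<close> of elements strictly above \<open>a\<close>. Hence the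
  dimension of the space of vectors of \<open>M(a)\<close> killed along such a \<open>T\<close> is additive on the exact sequences
  (\<open>annihilated_dim_additive\<close>) and gives a function on \<open>G\<close> that vanishes on \<open>E\<close>. The rank of \<open>M(a,b)\<close>
  is the difference of two such dimensions, that of \<open>M(a)\<close> and that of the kernel of \<open>M(a,b)\<close>.

  \<^emph>\<open>Branching.\<close> Let \<open>x\<close> and \<open>y\<close> be incomparable elements above \<open>a\<close>, and put \<open>A = [a,x]\<close> and
  \<open>B = [a,y]\<close>. The rank of the interval module of a subset of \<open>{z. a \<le> z}\<close> that is closed downwards
  to \<open>a\<close>, taken from a point above \<open>a\<close>, only asks whether the target lies in the subset, and all other
  ranks are zero; so by inclusion-exclusion the combination
  \<open>(A \<union> B) + (A \<inter> B) - A - B\<close> has rank zero. It is not in \<open>E\<close>: among the four modules only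
  the one on \<open>A \<inter> B\<close> has a nonzero vector at \<open>a\<close> that dies at both \<open>x\<close> and \<open>y\<close>
  (\<open>rank_null_not_exact_if_branching\<close>).

  \<^emph>\<open>Chains.\<close> If all principal up-sets are chains, the single-source spreads are the intervals \<open>[a,b]\<close>.
  Let \<open>M\<close> be nonzero and \<open>a\<close> minimal in its support. The kernels of the maps \<open>M(a,y)\<close> form a chain,
  so some nonzero \<open>v\<close> in \<open>M(a)\<close> lies in all the nonzero ones. The support of the submodule generated by
  \<open>v\<close> is an interval \<open>[a,b]\<close>. Replacing \<open>M(a)\<close> by a complement of \<open>v\<close> gives a smaller submodule \<open>M'\<close>,
  and the sequence
  \<open>0 \<rightarrow> K(a,b] \<rightarrow> K[a,b] \<oplus> M' \<rightarrow> M \<rightarrow> 0\<close>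
  is in the exact structure by the choice of \<open>v\<close> (\<open>one_generator_exact_relation\<close>); here \<open>(a,b]\<close> is empty
  or again an interval with a single source. By induction on the total dimension, the interval modules
  generate \<open>G/E\<close> (\<open>interval_spanned_module\<close>). Their rank vectors are linearly independent, since
  the incidence matrix of the inclusion order of intervals is unitriangular
  (\<open>incidence_sums_zero_imp_zero\<close>), and so \<open>R \<subseteq> E\<close>.
\<close>

section \<open>Finite-dimensional subspaces of the coordinate space\<close>

interpretation KN: vector_space_pair vscale vscale
  by unfold_locales

lemma fd_space_subspace: "fd_space V \<Longrightarrow> KN.subspace V"
  by (auto simp: fd_space_def)

lemma fd_space_of_subspace:
  assumes "fd_space V" "KN.subspace U" "U \<subseteq> V"
  shows "fd_space U"
proof -
  obtain B where B: "finite B" "V = KN.span B"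
    using assms(1) by (auto simp: fd_space_def)
  obtain C where C: "C \<subseteq> U" "KN.independent C" "U \<subseteq> KN.span C"
    by (rule KN.basis_exists)
  have "finite C"
    using KN.independent_span_bound[of B C] B C assms(3) by auto
  moreover have "U = KN.span C"
    using C assms(2) by (metis KN.span_minimal subset_antisym)
  ultimately show ?thesis
    by (auto simp: fd_space_def)
qed

lemma linear_map_in: "linear_map V W f \<Longrightarrow> v \<in> V \<Longrightarrow> f v \<in> W"
  and linear_map_add: "linear_map V W f \<Longrightarrow> u \<in> V \<Longrightarrow> v \<in> V \<Longrightarrow> f (u + v) = f u + f v"
  and linear_map_scale: "linear_map V W f \<Longrightarrow> v \<in> V \<Longrightarrow> f (vscale c v) = vscale c (f v)"
  unfolding linear_map_def by blast+

lemma linear_map_zero: "linear_map V W f \<Longrightarrow> 0 \<in> V \<Longrightarrow> f 0 = 0"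
proof -
  assume "linear_map V W f" "0 \<in> V"
  then have "f (0 + 0) = f 0 + f 0" unfolding linear_map_def by blast
  then show ?thesis by simp
qed

lemma linear_map_subset: "linear_map V W f \<Longrightarrow> U \<subseteq> V \<Longrightarrow> linear_map U (f ` U) f"
  by (auto simp: linear_map_def subset_iff)

lemma kernel_subspace:
  assumes "KN.subspace V" "linear_map V W f"
  shows "KN.subspace {v \<in> V. f v = 0}"
  using assms linear_map_zero[OF assms(2) KN.subspace_0[OF assms(1)]]
    linear_map_add[OF assms(2)] linear_map_scale[OF assms(2)]
  by (auto simp: KN.subspace_def KN.scale_zero_right)

lemma disjoint_basis_parts_span_zero:
  assumes "KN.independent B" "C \<subseteq> B" "x \<in> KN.span C" "x \<in> KN.span (B - C)"
  shows "x = 0"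
proof -
  have 1: "KN.representation B x = KN.representation C x"
    using KN.representation_extend assms by blast
  have 2: "KN.representation B x = KN.representation (B - C) x"
    using KN.representation_extend assms by blast
  have "KN.representation B x b = 0" for b
    using 1 2 KN.representation_ne_zero[of C x b] KN.representation_ne_zero[of "B - C" x b]
    by (metis DiffE)
  moreover have "x \<in> KN.span B"
    using assms KN.span_mono by blast
  ultimately show ?thesis
    using KN.sum_nonzero_representation_eq[OF assms(1), of x] by simp
qed

text \<open>
  A basis of the kernel is extended to a basis of the domain; the additional basis vectors are mapped
  injectively onto a basis of the image. As \<open>f\<close> is linear on \<open>V\<close> only, the library results are applied
  to a linear map \<open>g\<close> on the whole space that agrees with \<open>f\<close> on \<open>V\<close>.
\<close>
lemma rank_nullity:
  assumes V: "fd_space V" and f: "linear_map V W f"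
  shows "KN.dim V = KN.dim {v \<in> V. f v = 0} + KN.dim (f ` V)"
proof -
  let ?Z = "{v \<in> V. f v = 0}"
  have sV: "KN.subspace V" using V by (rule fd_space_subspace)
  obtain B0 where B0: "B0 \<subseteq> ?Z" "KN.independent B0" "?Z \<subseteq> KN.span B0"
    by (rule KN.basis_exists)
  obtain B where B: "B0 \<subseteq> B" "B \<subseteq> V" "KN.independent B" "V \<subseteq> KN.span B"
    using KN.maximal_independent_subset_extend[of B0 V] B0 by auto
  have spanB: "KN.span B = V"
    using B sV KN.span_minimal by blast
  have finB: "finite B"
    using V B by (metis KN.independent_span_bound fd_space_def order_trans KN.span_superset spanB)
  define g where "g = KN.construct B f"
  have lin: "Vector_Spaces.linear vscale vscale g"
    unfolding g_def by (rule KN.linear_construct[OF B(3)])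
  have gf: "g v = f v" if "v \<in> V" for v
  proof -
    have "v \<in> KN.span B" using that spanB by simp
    then have "v \<in> V \<and> g v = f v"
    proof (induction rule: KN.span_induct_alt)
      case base
      show ?case
        using linear_map_zero[OF f] sV lin KN.linear_0 KN.subspace_0 by metis
    next
      case (step c x y)
      have "x \<in> V" "y \<in> V" using step B(2) by auto
      moreover from this have "vscale c x \<in> V" using sV KN.subspace_scale by blast
      moreover from calculation have "vscale c x + y \<in> V" using sV KN.subspace_add by blast
      moreover have "g (vscale c x + y) = vscale c (g x) + g y"
        using lin KN.linear_add KN.linear_scale by metis
      moreover have "g x = f x"
        using step(1) KN.construct_basis[OF B(3)] by (simp add: g_def)
      ultimately show ?case
        using step.IH linear_map_add[OF f] linear_map_scale[OF f] by metis
    qed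
    then show ?thesis by blast
  qed
  have inj: "inj_on g (KN.span (B - B0))"
  proof (subst KN.linear_inj_on_iff_eq_0[OF lin KN.subspace_span], intro ballI impI)
    fix x assume x: "x \<in> KN.span (B - B0)" "g x = 0"
    then have "x \<in> V"
      using spanB KN.span_mono[of "B - B0" B] by auto
    then have "x \<in> KN.span B0"
      using x gf B0(3) by auto
    then show "x = 0"
      using disjoint_basis_parts_span_zero[OF B(3) B(1)] x(1) by blast
  qed
  have ind: "KN.independent (g ` (B - B0))"
    by (rule KN.linear_independent_injective_image[OF lin _ inj])
       (use B(3) KN.independent_mono in blast)
  have fV: "f ` V = g ` V" using gf by (auto simp: image_iff)
  have "f ` V = KN.span (g ` B)"
    unfolding fV by (metis KN.linear_span_image[OF lin] spanB)
  also have "\<dots> = KN.span (g ` (B - B0))"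
  proof (rule KN.span_eq[THEN iffD2], intro conjI image_subsetI)
    fix b assume "b \<in> B"
    show "g b \<in> KN.span (g ` (B - B0))"
    proof (cases "b \<in> B0")
      case True
      then have "g b = 0" using B0(1) gf by auto
      then show ?thesis by (simp add: KN.span_zero)
    qed (use \<open>b \<in> B\<close> in \<open>auto intro: KN.span_base\<close>)
  qed (auto intro: KN.span_base)
  finally have "KN.dim (f ` V) = card (g ` (B - B0))"
    using ind KN.dim_span_eq_card_independent by metis
  also have "\<dots> = card (B - B0)"
    using inj KN.span_superset card_image inj_on_subset by metis
  finally have "KN.dim (f ` V) = card (B - B0)" .
  moreover have "KN.dim ?Z = card B0"
    using KN.basis_card_eq_dim[OF B0(1,3,2)] by simp
  moreover have "KN.dim V = card B"
    using KN.basis_card_eq_dim[OF B(2,4,3)] by simp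
  moreover have "card B = card B0 + card (B - B0)"
    using B(1) finB by (metis card_Diff_subset card_mono finite_subset le_add_diff_inverse)
  ultimately show ?thesis by simp
qed

lemma dim_zero_space [simp]: "KN.dim {0} = 0"
  by (rule KN.dim_unique[of "{}"]) (simp_all add: KN.span_empty KN.independent_empty)

lemma dim_injective_image:
  assumes "fd_space V" "linear_map V W f" "inj_on f V"
  shows "KN.dim (f ` V) = KN.dim V"
proof -
  have "0 \<in> V" using assms(1) fd_space_subspace KN.subspace_0 by blast
  then have "{v \<in> V. f v = 0} = {0}"
    using linear_map_zero[OF assms(2)] assms(3) by (auto simp: inj_on_def)
  then show ?thesis
    using rank_nullity[OF assms(1,2)] by simp
qed

lemma fd_space_complement_of_vector:
  assumes V: "fd_space V" and v: "v \<in> V" "v \<noteq> 0"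
  obtains H where "fd_space H" "H \<subseteq> V" "v \<notin> H" "KN.dim H < KN.dim V"
    "\<forall>w\<in>V. \<exists>c h. h \<in> H \<and> w = vscale c v + h"
proof -
  have sV: "KN.subspace V" using V by (rule fd_space_subspace)
  obtain B where B: "{v} \<subseteq> B" "B \<subseteq> V" "KN.independent B" "V \<subseteq> KN.span B"
    using KN.maximal_independent_subset_extend[of "{v}" V] v by auto
  have finB: "finite B"
    using V B by (metis KN.independent_span_bound fd_space_def order_trans)
  let ?H = "KN.span (B - {v})"
  have ind: "KN.independent (B - {v})" using B(3) KN.independent_mono by blast
  show ?thesis
  proof
    show "fd_space ?H" using finB by (auto simp: fd_space_def)
    show "?H \<subseteq> V" using B(2) sV by (intro KN.span_minimal) auto
    show "v \<notin> ?H" using B(1,3) by (auto simp: KN.dependent_def)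
    have "KN.dim ?H = card (B - {v})" using ind by (rule KN.dim_span_eq_card_independent)
    also have "\<dots> < card B" using B(1) finB by (intro psubset_card_mono) auto
    also have "card B = KN.dim V" by (rule KN.basis_card_eq_dim[OF B(2,4,3)])
    finally show "KN.dim ?H < KN.dim V" .
    show "\<forall>w\<in>V. \<exists>c h. h \<in> ?H \<and> w = vscale c v + h"
    proof
      fix w assume "w \<in> V"
      then have "w \<in> KN.span (insert v (B - {v}))" using B(1,4) by (auto simp: insert_absorb)
      then obtain k where k: "w - vscale k v \<in> ?H" using KN.span_breakdown_eq by blast
      then show "\<exists>c h. h \<in> ?H \<and> w = vscale c v + h"
        by (intro exI[of _ k] exI[of _ "w - vscale k v"]) simp
    qed
  qed
qed

lemma vscale_apply: "vscale c v i = c * v i"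
  by (simp add: vscale_def)

definition coord_line :: "(nat \<Rightarrow> 'k::field) set" where
  "coord_line = {v. \<forall>i>0. v i = 0}"

definition line_unit :: "nat \<Rightarrow> 'k::field" where
  "line_unit = (\<lambda>i. if i = 0 then 1 else 0)"

lemma coord_line_eq_scaled_unit: "v \<in> coord_line \<Longrightarrow> v = vscale (v 0) line_unit"
  by (auto simp: coord_line_def line_unit_def vscale_def fun_eq_iff)

lemma line_unit_in_line [simp]: "line_unit \<in> coord_line"
  by (auto simp: coord_line_def line_unit_def)

lemma line_unit_0 [simp]: "line_unit 0 = 1"
  by (simp add: line_unit_def)

lemma line_unit_nonzero [simp]: "line_unit \<noteq> 0"
  by (auto simp: line_unit_def fun_eq_iff)

lemma coord_line_eq_span: "coord_line = KN.span {line_unit}"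
  by (auto simp: KN.span_singleton image_iff intro: coord_line_eq_scaled_unit)
     (auto simp: coord_line_def vscale_def line_unit_def)

lemma fd_space_coord_line: "fd_space coord_line"
  unfolding fd_space_def coord_line_eq_span by blast

lemma fd_space_zero: "fd_space {0}"
  unfolding fd_space_def by (rule exI[of _ "{}"]) (simp add: KN.span_empty)

lemma dim_coord_line [simp]: "KN.dim (coord_line :: (nat \<Rightarrow> 'k::field) set) = 1"
proof -
  have "KN.independent {line_unit :: nat \<Rightarrow> 'k}"
    by (rule KN.independent_insertI) (simp_all add: KN.span_empty KN.independent_empty)
  then show ?thesis
    by (simp add: coord_line_eq_span KN.dim_span_eq_card_independent del: KN.dim_span)
qed

section \<open>Modules and interval modules\<close>

lemma module_fd: "is_module M \<Longrightarrow> fd_space (vspace M a)"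
  and module_linear: "is_module M \<Longrightarrow> a \<le> b \<Longrightarrow> linear_map (vspace M a) (vspace M b) (trans_map M a b)"
  and module_id: "is_module M \<Longrightarrow> v \<in> vspace M a \<Longrightarrow> trans_map M a a v = v"
  and module_comp: "is_module M \<Longrightarrow> a \<le> b \<Longrightarrow> b \<le> c \<Longrightarrow> v \<in> vspace M a \<Longrightarrow>
    trans_map M b c (trans_map M a b v) = trans_map M a c v"
  by (simp_all add: is_module_def)

lemma module_subspace: "is_module M \<Longrightarrow> KN.subspace (vspace M a)"
  using module_fd fd_space_subspace by blast

lemma module_zero: "is_module M \<Longrightarrow> 0 \<in> vspace M a"
  using module_subspace KN.subspace_0 by blast

lemma module_in: "is_module M \<Longrightarrow> a \<le> b \<Longrightarrow> v \<in> vspace M a \<Longrightarrow> trans_map M a b v \<in> vspace M b"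
  using module_linear linear_map_in by blast

lemma hom_linear: "pmod_hom M N f \<Longrightarrow> linear_map (vspace M a) (vspace N a) (f a)"
  and hom_commutes: "pmod_hom M N f \<Longrightarrow> a \<le> b \<Longrightarrow> v \<in> vspace M a \<Longrightarrow>
    f b (trans_map M a b v) = trans_map N a b (f a v)"
  unfolding pmod_hom_def by blast+

text \<open>
  The spread modules only depend on the set of points spanned. Taking that set as the parameter also
  covers the zero module (the empty set) and spares the choice of an antichain.
\<close>
definition interval_module :: "'p::{finite,order} set \<Rightarrow> ('p, 'k::field) pmod" where
  "interval_module D =
     \<lparr> vspace = (\<lambda>x. if x \<in> D then coord_line else {0}),
       trans_map = (\<lambda>x y v. if x \<in> D \<and> y \<in> D then v else 0) \<rparr>"

lemma vspace_interval_module [simp]: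
    "vspace (interval_module D) x = (if x \<in> D then coord_line else {0})"
  and trans_map_interval_module [simp]:
    "trans_map (interval_module D) x y v = (if x \<in> D \<and> y \<in> D then v else 0)"
  by (simp_all add: interval_module_def)

lemma spread_module_eq_interval_module: "spread_module a B = interval_module (spread a B)"
  unfolding spread_module_def interval_module_def coord_line_def by (rule refl)

lemma vspace_spread_module:
    "vspace (spread_module a B) x = (if x \<in> spread a B then coord_line else {0})"
  and trans_map_spread_module:
    "trans_map (spread_module a B) x y v
       = (if x \<in> spread a B \<and> y \<in> spread a B then v else 0)"
  by (simp_all add: spread_module_eq_interval_module)

lemma is_module_interval_module:
  assumes "\<And>x y z. x \<in> D \<Longrightarrow> z \<in> D \<Longrightarrow> x \<le> y \<Longrightarrow> y \<le> z \<Longrightarrow> y \<in> D"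
  shows "is_module (interval_module D :: ('p::{finite,order}, 'k::field) pmod)"
proof -
  have l: "(0 :: nat \<Rightarrow> 'k) \<in> coord_line" by (simp add: coord_line_def)
  have z: "vscale c (0 :: nat \<Rightarrow> 'k) = 0" for c by (rule KN.scale_zero_right)
  show ?thesis
    unfolding is_module_def
  proof (intro conjI allI impI ballI)
    fix a b :: 'p
    show "fd_space (vspace (interval_module D :: ('p, 'k) pmod) a)"
      by (simp add: fd_space_coord_line fd_space_zero)
    show "linear_map (vspace (interval_module D :: ('p, 'k) pmod) a) (vspace (interval_module D) b)
        (trans_map (interval_module D) a b)"
      by (cases "a \<in> D"; cases "b \<in> D") (auto simp: linear_map_def z l)
    fix v :: "nat \<Rightarrow> 'k"
    assume v: "v \<in> vspace (interval_module D) a"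
    show "trans_map (interval_module D) a a v = v"
      using v by (cases "a \<in> D") simp_all
    fix c assume "a \<le> b" "b \<le> c"
    then have "b \<in> D" if "a \<in> D" "c \<in> D" using assms that by blast
    then show "trans_map (interval_module D) b c (trans_map (interval_module D) a b v)
        = trans_map (interval_module D) a c v"
      by simp
  qed
qed

lemma is_module_spread_module: "is_module (spread_module a B)"
  unfolding spread_module_eq_interval_module
  by (rule is_module_interval_module) (auto simp: spread_def intro: order_trans)

text \<open>The generating antichain consists of the maximal elements of the down-set.\<close>
lemma spread_of_down_set:
  fixes a :: "'p::{finite,order}"
  assumes "a \<in> D" "D \<subseteq> {a..}" "\<And>x y. y \<in> D \<Longrightarrow> a \<le> x \<Longrightarrow> x \<le> y \<Longrightarrow> x \<in> D"
  obtains B where "single_source_pair a B" "spread a B = D"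
proof
  let ?B = "{b \<in> D. \<forall>y\<in>D. b \<le> y \<longrightarrow> b = y}"
  have m: "\<exists>b\<in>?B. x \<le> b" if "x \<in> D" for x
  proof -
    have "finite {y \<in> D. x \<le> y}" "x \<in> {y \<in> D. x \<le> y}" using that by auto
    then obtain b where b: "b \<in> {y \<in> D. x \<le> y}" "\<forall>y\<in>{y \<in> D. x \<le> y}. b \<le> y \<longrightarrow> b = y"
      using finite_has_maximal2[of "{y \<in> D. x \<le> y}" x] by blast
    then have "\<forall>y\<in>D. b \<le> y \<longrightarrow> b = y" using order_trans[of x b] by blast
    with b(1) show ?thesis by blast
  qed
  show "single_source_pair a ?B"
    using m[OF assms(1)] assms(2) unfolding single_source_pair_def by auto
  show "spread a ?B = D"
    using m assms(2,3) unfolding spread_def by auto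
qed

section \<open>Homomorphisms out of single-source spread modules\<close>

text \<open>
  For \<open>T\<close> the complement of a spread in \<open>{a..}\<close>, this is the space of homomorphisms from the spread
  module to \<open>M\<close>, each recorded by the image of the generator at \<open>a\<close>.
\<close>
definition annihilated :: "('p::{finite,order}, 'k::field) pmod \<Rightarrow> 'p \<Rightarrow> 'p set \<Rightarrow> (nat \<Rightarrow> 'k) set" where
  "annihilated M a T = {w \<in> vspace M a. \<forall>y\<in>T. trans_map M a y w = 0}"

lemma fd_space_annihilated:
  assumes M: "is_module M" and T: "T \<subseteq> {a..}"
  shows "fd_space (annihilated M a T)"
proof (rule fd_space_of_subspace[OF module_fd[OF M]])
  have "annihilated M a T = vspace M a \<inter> (\<Inter>y\<in>T. {v \<in> vspace M a. trans_map M a y v = 0})"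
    by (auto simp: annihilated_def)
  moreover have "KN.subspace {v \<in> vspace M a. trans_map M a y v = 0}" if "y \<in> T" for y
    by (rule kernel_subspace[OF module_subspace[OF M] module_linear[OF M]]) (use T that in auto)
  ultimately show "KN.subspace (annihilated M a T)"
    using module_subspace[OF M] by (auto intro!: KN.subspace_Int KN.subspace_inter)
qed (auto simp: annihilated_def)

lemma spread_hom_gives_annihilated:
  assumes h: "pmod_hom (spread_module a B) M h" and ss: "single_source_pair a B"
  shows "h a line_unit \<in> annihilated M a ({a..} - spread a B)"
    and "\<And>x s. x \<in> spread a B \<Longrightarrow> s \<in> coord_line \<Longrightarrow>
           h x s = vscale (s 0) (trans_map M a x (h a line_unit))"
proof -
  have aD: "a \<in> spread a B"
    using ss by (auto simp: spread_def single_source_pair_def)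
  have la: "line_unit \<in> vspace (spread_module a B) a"
    using aD by (simp add: spread_module_eq_interval_module)
  have "trans_map M a y (h a line_unit) = 0" if "y \<in> {a..} - spread a B" for y
  proof -
    have "trans_map M a y (h a line_unit) = h y (trans_map (spread_module a B) a y line_unit)"
      using hom_commutes[OF h _ la] that by auto
    also have "\<dots> = h y 0"
      using that by (simp add: spread_module_eq_interval_module)
    also have "\<dots> = 0"
      by (rule linear_map_zero[OF hom_linear[OF h]]) (rule module_zero[OF is_module_spread_module])
    finally show ?thesis .
  qed
  then show "h a line_unit \<in> annihilated M a ({a..} - spread a B)"
    using linear_map_in[OF hom_linear[OF h] la] by (simp add: annihilated_def)
  fix x and s :: "nat \<Rightarrow> 'b"
  assume x: "x \<in> spread a B" and s: "s \<in> coord_line"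
  have ax: "a \<le> x" using x by (simp add: spread_def)
  have lx: "line_unit \<in> vspace (spread_module a B) x"
    using x by (simp add: spread_module_eq_interval_module)
  have "h x s = h x (vscale (s 0) line_unit)"
    using coord_line_eq_scaled_unit[OF s] by simp
  also have "\<dots> = vscale (s 0) (h x line_unit)"
    by (rule linear_map_scale[OF hom_linear[OF h] lx])
  also have "h x line_unit = h x (trans_map (spread_module a B) a x line_unit)"
    using x aD by (simp add: spread_module_eq_interval_module)
  also have "\<dots> = trans_map M a x (h a line_unit)"
    by (rule hom_commutes[OF h ax la])
  finally show "h x s = vscale (s 0) (trans_map M a x (h a line_unit))" .
qed

lemma annihilated_gives_spread_hom:
  assumes M: "is_module M" and w: "w \<in> annihilated M a ({a..} - spread a B)"
  shows "pmod_hom (spread_module a B) M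
    (\<lambda>x s. if x \<in> spread a B then vscale (s 0) (trans_map M a x w) else 0)"
    (is "pmod_hom _ M ?h")
proof -
  have wM: "w \<in> vspace M a" using w by (simp add: annihilated_def)
  have "linear_map (vspace (spread_module a B) x) (vspace M x) (?h x)" for x
  proof (cases "x \<in> spread a B")
    case True
    then have "trans_map M a x w \<in> vspace M x"
      using module_in[OF M _ wM] by (auto simp: spread_def)
    then show ?thesis
      using True KN.subspace_scale[OF module_subspace[OF M]]
      by (simp add: linear_map_def KN.scale_left_distrib vscale_apply)
  next
    case False
    then show ?thesis
      using module_zero[OF M] by (auto simp: linear_map_def KN.scale_zero_right)
  qed
  moreover have "?h y (trans_map (spread_module a B) x y s) = trans_map M x y (?h x s)"
    if xy: "x \<le> y" for x y s
  proof (cases "x \<in> spread a B")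
    case True
    then have ax: "a \<le> x" by (simp add: spread_def)
    have "trans_map M x y (?h x s) = vscale (s 0) (trans_map M a y w)"
      using True linear_map_scale[OF module_linear[OF M xy] module_in[OF M ax wM]]
        module_comp[OF M ax xy wM] by simp
    moreover have "y \<notin> spread a B \<Longrightarrow> trans_map M a y w = 0"
      using w ax xy by (auto simp: annihilated_def)
    ultimately show ?thesis
      using True by (auto simp: spread_module_eq_interval_module KN.scale_zero_right)
  next
    case False
    then show ?thesis
      using linear_map_zero[OF module_linear[OF M xy] module_zero[OF M]]
      by (simp add: trans_map_spread_module KN.scale_zero_left)
  qed
  ultimately show ?thesis
    unfolding pmod_hom_def by blast
qed

text \<open>
  Under the identification of homomorphisms with annihilated vectors, lifting a homomorphism along \<open>g\<close>
  means lifting one vector at the source. Membership in the exact structure thus becomes a condition on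
  the components \<open>g a\<close>.
\<close>
lemma Hom_surjective_spread_iff:
  assumes N: "is_module N" and L: "is_module L" and g: "pmod_hom N L g"
    and ss: "single_source_pair a B"
  shows "Hom_surjective (spread_module a B) N g L \<longleftrightarrow>
    annihilated L a ({a..} - spread a B) \<subseteq> g a ` annihilated N a ({a..} - spread a B)"
    (is "_ \<longleftrightarrow> ?AL \<subseteq> g a ` ?AN")
proof
  have aD: "a \<in> spread a B"
    using ss by (auto simp: spread_def single_source_pair_def)
  {
    assume surj: "Hom_surjective (spread_module a B) N g L"
    show "?AL \<subseteq> g a ` ?AN"
    proof
      fix w assume w: "w \<in> ?AL"
      then have wL: "w \<in> vspace L a" by (simp add: annihilated_def)
      obtain h' where h': "pmod_hom (spread_module a B) N h'"
        "\<And>x v. v \<in> vspace (spread_module a B) x \<Longrightarrow>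
           g x (h' x v) = (if x \<in> spread a B then vscale (v 0) (trans_map L a x w) else 0)"
        using surj annihilated_gives_spread_hom[OF L w] unfolding Hom_surjective_def by blast
      have "line_unit \<in> vspace (spread_module a B) a"
        using aD by (simp add: vspace_spread_module)
      then have "g a (h' a line_unit) = w"
        using h'(2)[of line_unit a] aD module_id[OF L wL] by (simp add: KN.scale_one)
      then show "w \<in> g a ` ?AN"
        using spread_hom_gives_annihilated(1)[OF h'(1) ss] by blast
    qed
  }
  assume sub: "?AL \<subseteq> g a ` ?AN"
  show "Hom_surjective (spread_module a B) N g L"
    unfolding Hom_surjective_def
  proof (intro allI impI)
    fix h assume h: "pmod_hom (spread_module a B) L h"
    obtain w where w: "w \<in> ?AN" "h a line_unit = g a w"
      using sub spread_hom_gives_annihilated(1)[OF h ss] by blast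
    have wN: "w \<in> vspace N a" using w by (simp add: annihilated_def)
    let ?h' = "\<lambda>x s. if x \<in> spread a B then vscale (s 0) (trans_map N a x w) else 0"
    have "g x (?h' x s) = h x s" if s: "s \<in> vspace (spread_module a B) x" for x s
    proof (cases "x \<in> spread a B")
      case True
      then have ax: "a \<le> x" by (simp add: spread_def)
      have "g x (?h' x s) = vscale (s 0) (g x (trans_map N a x w))"
        using True linear_map_scale[OF hom_linear[OF g] module_in[OF N ax wN]] by simp
      also have "g x (trans_map N a x w) = trans_map L a x (g a w)"
        by (rule hom_commutes[OF g ax wN])
      finally show ?thesis
        using spread_hom_gives_annihilated(2)[OF h ss True, of s] s True w(2)
        by (simp add: vspace_spread_module)
    next
      case False
      then show ?thesis
        using s linear_map_zero[OF hom_linear[OF g] module_zero[OF N]]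
          linear_map_zero[OF hom_linear[OF h] module_zero[OF is_module_spread_module]]
        by (simp add: vspace_spread_module)
    qed
    then show "\<exists>h'. pmod_hom (spread_module a B) N h' \<and>
        (\<forall>x. \<forall>v\<in>vspace (spread_module a B) x. g x (h' x v) = h x v)"
      using annihilated_gives_spread_hom[OF N w(1)] by blast
  qed
qed

text \<open>
  If \<open>a \<notin> T\<close>, then \<open>{a..} - T\<close> is a single-source spread, and additivity is the exactness of
  the functor represented by its module. If \<open>a \<in> T\<close>, all three spaces are zero.
\<close>
lemma annihilated_dim_additive:
  assumes ex: "short_exact M f N g L"
    and surj: "\<And>R. R \<in> single_source_spread_modules \<Longrightarrow> Hom_surjective R N g L"
    and T: "T \<subseteq> {a..}" "\<And>x y. x \<in> T \<Longrightarrow> x \<le> y \<Longrightarrow> y \<in> T"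
  shows "KN.dim (annihilated N a T) = KN.dim (annihilated M a T) + KN.dim (annihilated L a T)"
proof -
  have mods: "is_module M" "is_module N" "is_module L"
    and f: "pmod_hom M N f" and g: "pmod_hom N L g"
    and inj: "\<And>a. inj_on (f a) (vspace M a)"
    and ker: "\<And>a. f a ` vspace M a = {v \<in> vspace N a. g a v = 0}"
    using ex unfolding short_exact_def by auto
  show ?thesis
  proof (cases "a \<in> T")
    case True
    have "annihilated Q a T = {0}" if "is_module Q" for Q :: "('a, 'b) pmod"
      using True module_id[OF that] module_zero[OF that] T(1)
        linear_map_zero[OF module_linear[OF that] module_zero[OF that]]
      by (auto simp: annihilated_def subset_iff)
    then show ?thesis using mods by simp
  next
    case False
    obtain B where B: "single_source_pair a B" "spread a B = {a..} - T"
      by (rule spread_of_down_set[of a "{a..} - T"]) (use False T in auto)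
    have TB: "{a..} - spread a B = T" using B T by auto
    let ?A = "\<lambda>Q. annihilated Q a T"
    have gin: "g a w \<in> ?A L" if "w \<in> ?A N" for w
    proof -
      have wN: "w \<in> vspace N a" using that by (simp add: annihilated_def)
      have "trans_map L a y (g a w) = 0" if y: "y \<in> T" for y
      proof -
        have "trans_map L a y (g a w) = g y (trans_map N a y w)"
          using hom_commutes[OF g _ wN] y T(1) by auto
        also have "trans_map N a y w = 0" using \<open>w \<in> ?A N\<close> y by (simp add: annihilated_def)
        also have "g y 0 = 0" by (rule linear_map_zero[OF hom_linear[OF g] module_zero[OF mods(2)]])
        finally show ?thesis .
      qed
      then show ?thesis
        using linear_map_in[OF hom_linear[OF g] wN] by (simp add: annihilated_def)
    qed
    have "spread_module a B \<in> single_source_spread_modules"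
      using B(1) by (auto simp: single_source_spread_modules_def)
    then have "?A L \<subseteq> g a ` ?A N"
      using Hom_surjective_spread_iff[OF mods(2,3) g B(1)] surj TB by auto
    then have im: "g a ` ?A N = ?A L" using gin by blast
    have kerA: "{v \<in> ?A N. g a v = 0} = f a ` ?A M"
    proof (intro subset_antisym subsetI)
      fix w assume w: "w \<in> {v \<in> ?A N. g a v = 0}"
      then obtain m where m: "m \<in> vspace M a" "w = f a m"
        using ker[of a] by (auto simp: annihilated_def)
      have "trans_map M a y m = 0" if y: "y \<in> T" for y
      proof -
        have ay: "a \<le> y" using y T by auto
        have "f y (trans_map M a y m) = f y 0"
          using w y m hom_commutes[OF f ay m(1)]
            linear_map_zero[OF hom_linear[OF f] module_zero[OF mods(1)]]
          by (simp add: annihilated_def)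
        then show ?thesis
          using inj[of y] module_in[OF mods(1) ay m(1)] module_zero[OF mods(1)]
          by (auto dest: inj_onD)
      qed
      then show "w \<in> f a ` ?A M" using m by (auto simp: annihilated_def)
    next
      fix w assume "w \<in> f a ` ?A M"
      then obtain m where m: "m \<in> ?A M" "w = f a m" by blast
      have mM: "m \<in> vspace M a" using m by (simp add: annihilated_def)
      have "w \<in> vspace N a" "g a w = 0" using ker[of a] mM m(2) by auto
      moreover have "trans_map N a y w = 0" if y: "y \<in> T" for y
      proof -
        have ay: "a \<le> y" using y T by auto
        show ?thesis
          using hom_commutes[OF f ay mM] m y
            linear_map_zero[OF hom_linear[OF f] module_zero[OF mods(1)]]
          by (simp add: annihilated_def)
      qed
      ultimately show "w \<in> {v \<in> ?A N. g a v = 0}" by (simp add: annihilated_def)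
    qed
    have AM: "?A M \<subseteq> vspace M a" and AN: "?A N \<subseteq> vspace N a" by (auto simp: annihilated_def)
    have "KN.dim (f a ` ?A M) = KN.dim (?A M)"
      by (rule dim_injective_image[OF fd_space_annihilated[OF mods(1) T(1)]
            linear_map_subset[OF hom_linear[OF f] AM] inj_on_subset[OF inj AM]])
    then show ?thesis
      using rank_nullity[OF fd_space_annihilated[OF mods(2) T(1)]
            linear_map_subset[OF hom_linear[OF g] AN]] im kerA by simp
  qed
qed

section \<open>Ranks\<close>

text \<open>This expresses ranks by functions that are already known to be additive.\<close>
lemma module_rank_plus_annihilated:
  assumes M: "is_module M" and ab: "a \<le> b"
  shows "KN.dim (annihilated M a {}) = KN.dim (annihilated M a {b..}) + module_rank M a b"
proof -
  have "annihilated M a {b..} = {v \<in> vspace M a. trans_map M a b v = 0}"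
  proof (intro subset_antisym subsetI)
    fix v assume v: "v \<in> {v \<in> vspace M a. trans_map M a b v = 0}"
    have "trans_map M a y v = 0" if "b \<le> y" for y
      using module_comp[OF M ab that] v linear_map_zero[OF module_linear[OF M that] module_zero[OF M]]
      by force
    then show "v \<in> annihilated M a {b..}" using v by (simp add: annihilated_def)
  qed (simp add: annihilated_def)
  then show ?thesis
    using rank_nullity[OF module_fd[OF M] module_linear[OF M ab]]
    by (simp add: module_rank_def annihilated_def)
qed

lemma annihilated_dim_iso:
  assumes iso: "pmod_iso M N" and M: "is_module M" and N: "is_module N" and T: "T \<subseteq> {a..}"
  shows "KN.dim (annihilated N a T) = KN.dim (annihilated M a T)"
proof -
  obtain f where f: "pmod_hom M N f" and bij: "\<And>a. bij_betw (f a) (vspace M a) (vspace N a)"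
    using iso by (auto simp: pmod_iso_def)
  let ?A = "\<lambda>Q. annihilated Q a T"
  have z: "trans_map N a y (f a m) = 0 \<longleftrightarrow> trans_map M a y m = 0"
    if "m \<in> vspace M a" "y \<in> T" for m y
  proof -
    have ay: "a \<le> y" using that T by auto
    have "inj_on (f y) (vspace M y)" using bij by (simp add: bij_betw_def)
    then have "f y (trans_map M a y m) = f y 0 \<longleftrightarrow> trans_map M a y m = 0"
      using module_in[OF M ay that(1)] module_zero[OF M] by (rule inj_on_eq_iff)
    then show ?thesis
      using hom_commutes[OF f ay that(1)] linear_map_zero[OF hom_linear[OF f] module_zero[OF M]]
      by simp
  qed
  have A: "?A M \<subseteq> vspace M a" by (auto simp: annihilated_def)
  have "f a ` ?A M = ?A N"
  proof
    show "f a ` ?A M \<subseteq> ?A N"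
      using z bij[of a] by (auto simp: annihilated_def bij_betw_def)
    show "?A N \<subseteq> f a ` ?A M"
    proof
      fix w assume w: "w \<in> ?A N"
      then obtain m where "m \<in> vspace M a" "w = f a m"
        using bij[of a] by (auto simp: annihilated_def bij_betw_def)
      then show "w \<in> f a ` ?A M" using w z by (auto simp: annihilated_def)
    qed
  qed
  moreover have "KN.dim (f a ` ?A M) = KN.dim (?A M)"
    by (rule dim_injective_image[OF fd_space_annihilated[OF M T]
          linear_map_subset[OF hom_linear[OF f] A]])
       (use bij[of a] A in \<open>auto simp: bij_betw_def intro: inj_on_subset\<close>)
  ultimately show ?thesis by simp
qed

lemma module_rank_iso:
  assumes "pmod_iso M N" "is_module M" "is_module N" "a \<le> b"
  shows "module_rank N a b = module_rank M a b"
  using annihilated_dim_iso[OF assms(1-3), of "{}" a] annihilated_dim_iso[OF assms(1-3), of "{b..}" a]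
    module_rank_plus_annihilated[OF assms(2,4)] module_rank_plus_annihilated[OF assms(3,4)] assms(4)
  by auto

lemma module_rank_additive:
  assumes ex: "short_exact M f N g L"
    and surj: "\<And>R. R \<in> single_source_spread_modules \<Longrightarrow> Hom_surjective R N g L"
    and ab: "a \<le> b"
  shows "module_rank N a b = module_rank M a b + module_rank L a b"
proof -
  have mods: "is_module M" "is_module N" "is_module L"
    using ex unfolding short_exact_def by auto
  show ?thesis
    using annihilated_dim_additive[OF ex surj, of "{}" a]
      annihilated_dim_additive[OF ex surj, of "{b..}" a] ab
      module_rank_plus_annihilated[OF mods(1) ab] module_rank_plus_annihilated[OF mods(2) ab]
      module_rank_plus_annihilated[OF mods(3) ab]
    by auto
qed

lemma module_rank_interval_module:
  "module_rank (interval_module D :: ('p::{finite,order}, 'k::field) pmod) a b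
     = of_bool (a \<in> D \<and> b \<in> D)"
proof -
  have "trans_map (interval_module D) a b ` vspace (interval_module D :: ('p, 'k) pmod) a
      = (if a \<in> D \<and> b \<in> D then coord_line else {0})"
    using imageI[OF line_unit_in_line, of "\<lambda>x. 0 :: nat \<Rightarrow> 'k"] by (cases "a \<in> D"; cases "b \<in> D") auto
  then show ?thesis by (simp add: module_rank_def)
qed

lemma dim_annihilated_interval_module:
  "KN.dim (annihilated (interval_module D :: ('p::{finite,order}, 'k::field) pmod) a T)
     = of_bool (a \<in> D \<and> D \<inter> T = {})"
proof -
  have l: "(0 :: nat \<Rightarrow> 'k) \<in> coord_line" by (simp add: coord_line_def)
  have "annihilated (interval_module D :: ('p, 'k) pmod) a T
      = (if a \<in> D \<and> D \<inter> T = {} then coord_line else {0})"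
  proof (cases "a \<in> D \<and> D \<inter> T = {}")
    case False
    then show ?thesis using l by (cases "a \<in> D") (auto simp: annihilated_def)
  qed (auto simp: annihilated_def)
  then show ?thesis by simp
qed

section \<open>Direct sums\<close>

lemma left_part_vjoin [simp]: "left_part (vjoin u v) = u"
  and right_part_vjoin [simp]: "right_part (vjoin u v) = v"
  by (simp_all add: left_part_def right_part_def vjoin_def)

lemma vjoin_parts [simp]: "vjoin (left_part w) (right_part w) = w"
proof
  fix n
  show "vjoin (left_part w) (right_part w) n = w n"
    using sum_decode_inverse[of n]
    by (cases "sum_decode n") (simp_all add: vjoin_def left_part_def right_part_def)
qed

lemma left_part_add: "left_part (u + v) = left_part u + left_part v"
  and right_part_add: "right_part (u + v) = right_part u + right_part v"
  and left_part_vscale: "left_part (vscale c u) = vscale c (left_part u)"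
  and right_part_vscale: "right_part (vscale c u) = vscale c (right_part u)"
  and left_part_zero [simp]: "left_part 0 = 0"
  and right_part_zero [simp]: "right_part 0 = 0"
  by (auto simp: left_part_def right_part_def vscale_def fun_eq_iff)

lemma vjoin_eq_iff: "vjoin u v = w \<longleftrightarrow> u = left_part w \<and> v = right_part w"
  by (metis left_part_vjoin right_part_vjoin vjoin_parts)

lemma vjoin_add:
  fixes u u' v v' :: "nat \<Rightarrow> 'k::field"
  shows "vjoin (u + u') (v + v') = vjoin u v + vjoin u' v'"
  by (simp add: vjoin_eq_iff left_part_add right_part_add)

lemma vjoin_vscale: "vjoin (vscale c u) (vscale c v) = vscale c (vjoin u v)"
  by (simp add: vjoin_eq_iff left_part_vscale right_part_vscale)

lemma vjoin_zero [simp]: "vjoin 0 0 = 0"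
  by (simp add: vjoin_eq_iff)

lemma vspace_direct_sum_iff:
  "w \<in> vspace (direct_sum M N) a \<longleftrightarrow> left_part w \<in> vspace M a \<and> right_part w \<in> vspace N a"
  by (simp add: direct_sum_def) (metis left_part_vjoin right_part_vjoin vjoin_parts)

lemma trans_map_direct_sum:
  "trans_map (direct_sum M N) a b w
     = vjoin (trans_map M a b (left_part w)) (trans_map N a b (right_part w))"
  by (simp add: direct_sum_def)

lemma fd_space_vjoin:
  assumes "fd_space V" "fd_space W"
  shows "fd_space {w. left_part w \<in> V \<and> right_part w \<in> W}"
proof -
  obtain A B where A: "finite A" "V = KN.span A" and B: "finite B" "W = KN.span B"
    using assms by (auto simp: fd_space_def)
  let ?l = "\<lambda>u. vjoin u 0" and ?r = "\<lambda>v. vjoin 0 v"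
  have l: "Vector_Spaces.linear vscale vscale ?l" and r: "Vector_Spaces.linear vscale vscale ?r"
    by (auto simp: Vector_Spaces.linear_iff KN.vector_space_axioms vjoin_eq_iff left_part_add right_part_add
        left_part_vscale right_part_vscale KN.scale_zero_right)
  have "KN.span (?l ` A \<union> ?r ` B) = {x + y | x y. x \<in> ?l ` V \<and> y \<in> ?r ` W}"
    unfolding KN.span_Un KN.linear_span_image[OF l] KN.linear_span_image[OF r] A(2) B(2) by simp
  also have "\<dots> = {w. left_part w \<in> V \<and> right_part w \<in> W}"
  proof (intro subset_antisym subsetI)
    fix w assume w: "w \<in> {w. left_part w \<in> V \<and> right_part w \<in> W}"
    have "w = vjoin (left_part w) 0 + vjoin 0 (right_part w)"
      by (metis add.left_neutral add.right_neutral vjoin_add vjoin_parts)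
    then show "w \<in> {x + y | x y. x \<in> ?l ` V \<and> y \<in> ?r ` W}" using w by blast
  qed (auto simp: left_part_add right_part_add)
  finally show ?thesis
    unfolding fd_space_def using A(1) B(1) by (intro exI[of _ "?l ` A \<union> ?r ` B"]) simp
qed

lemma linear_map_vjoin:
  assumes f: "linear_map V V' f" and g: "linear_map W W' g"
  shows "linear_map {w. left_part w \<in> V \<and> right_part w \<in> W}
    {w. left_part w \<in> V' \<and> right_part w \<in> W'} (\<lambda>w. vjoin (f (left_part w)) (g (right_part w)))"
  unfolding linear_map_def
proof (intro conjI ballI allI)
  fix u v c
  assume u: "u \<in> {w. left_part w \<in> V \<and> right_part w \<in> W}"
    and v: "v \<in> {w. left_part w \<in> V \<and> right_part w \<in> W}"
  show "vjoin (f (left_part (u + v))) (g (right_part (u + v)))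
      = vjoin (f (left_part u)) (g (right_part u)) + vjoin (f (left_part v)) (g (right_part v))"
    using u v linear_map_add[OF f] linear_map_add[OF g]
    by (simp add: left_part_add right_part_add vjoin_add)
next
  fix u v c
  assume v: "v \<in> {w. left_part w \<in> V \<and> right_part w \<in> W}"
  show "vjoin (f (left_part (vscale c v))) (g (right_part (vscale c v)))
      = vscale c (vjoin (f (left_part v)) (g (right_part v)))"
    using v linear_map_scale[OF f] linear_map_scale[OF g]
    by (simp add: left_part_vscale right_part_vscale vjoin_vscale)
qed (use linear_map_in[OF f] linear_map_in[OF g] in auto)

lemma is_module_direct_sum:
  assumes M: "is_module M" and N: "is_module N"
  shows "is_module (direct_sum M N)"
proof -
  have vs: "vspace (direct_sum M N) a
      = {w. left_part w \<in> vspace M a \<and> right_part w \<in> vspace N a}" for a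
    using vspace_direct_sum_iff by blast
  have tr: "trans_map (direct_sum M N) a b
      = (\<lambda>w. vjoin (trans_map M a b (left_part w)) (trans_map N a b (right_part w)))" for a b
    by (rule ext) (rule trans_map_direct_sum)
  show ?thesis
    unfolding is_module_def vs tr
    using fd_space_vjoin[OF module_fd[OF M] module_fd[OF N]]
      linear_map_vjoin[OF module_linear[OF M] module_linear[OF N]]
      module_id[OF M] module_id[OF N] module_comp[OF M] module_comp[OF N]
    by simp
qed

section \<open>Additive functions on the Grothendieck groups\<close>

text \<open>
  The group homomorphism from the free group to the integers given by a function on modules; the
  value on a class is meaningful when the function is invariant under isomorphism.
\<close>
definition class_extension :: "(('p::{finite,order}, 'k::field) pmod \<Rightarrow> nat) \<Rightarrow> ('p, 'k) free_elem \<Rightarrow> int" where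
  "class_extension f u =
     (\<Sum>C\<in>Poly_Mapping.keys u. Poly_Mapping.lookup u C * int (induced f C))"

lemma class_extension_superset:
  assumes "finite A" "Poly_Mapping.keys u \<subseteq> A"
  shows "class_extension f u = (\<Sum>C\<in>A. Poly_Mapping.lookup u C * int (induced f C))"
  unfolding class_extension_def
  by (rule sum.mono_neutral_left) (use assms in \<open>auto simp: in_keys_iff\<close>)

lemma class_extension_add: "class_extension f (u + v) = class_extension f u + class_extension f v"
proof -
  let ?A = "Poly_Mapping.keys u \<union> Poly_Mapping.keys v"
  show ?thesis
    using class_extension_superset[of ?A u f] class_extension_superset[of ?A v f]
      class_extension_superset[of ?A "u + v" f] keys_add[of u v]
    by (simp add: lookup_add distrib_right sum.distrib)
qed

lemma class_extension_frag_cmul: "class_extension f (frag_cmul c u) = c * class_extension f u"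
  using class_extension_superset[of "Poly_Mapping.keys u" "frag_cmul c u" f] keys_cmul[of c u]
  by (simp add: class_extension_def sum_distrib_left mult.assoc)

lemma class_extension_zero: "class_extension f 0 = 0"
  by (simp add: class_extension_def)

lemma class_extension_uminus: "class_extension f (- u) = - class_extension f u"
  using class_extension_add[of f u "- u"] by (simp add: class_extension_zero)

lemma class_extension_diff: "class_extension f (u - v) = class_extension f u - class_extension f v"
  using class_extension_add[of f "u - v" v] by simp

lemma class_extension_sum: "class_extension f (sum g A) = (\<Sum>i\<in>A. class_extension f (g i))"
  by (induction A rule: infinite_finite_induct) (simp_all add: class_extension_zero class_extension_add)

lemma pmod_iso_refl: "pmod_iso M M"
  unfolding pmod_iso_def pmod_hom_def linear_map_def
  by (rule exI[of _ "\<lambda>a v. v"]) (auto simp: bij_betw_def inj_on_def)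

lemma class_extension_iso_class:
  assumes M: "is_module M"
    and inv: "\<And>M N. is_module M \<Longrightarrow> is_module N \<Longrightarrow> pmod_iso M N \<Longrightarrow> f N = f M"
  shows "class_extension f (frag_of (iso_class M)) = int (f M)"
proof -
  have "f N = f M" if "N \<in> iso_class M" for N
    using that inv[OF M] unfolding iso_class_def by blast
  moreover have "M \<in> iso_class M"
    using M pmod_iso_refl by (simp add: iso_class_def)
  ultimately have "f ` iso_class M = {f M}"
    by blast
  then have "induced f (iso_class M) = f M"
    by (simp add: induced_def)
  then show ?thesis
    by (simp add: class_extension_def)
qed

lemma class_extension_vanishes_on_exact_relations:
  assumes u: "u \<in> exact_relations X"
    and inv: "\<And>M N. is_module M \<Longrightarrow> is_module N \<Longrightarrow> pmod_iso M N \<Longrightarrow> f N = f M"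
    and additive: "\<And>M i N g L. short_exact M i N g L \<Longrightarrow> (\<And>R. R \<in> X \<Longrightarrow> Hom_surjective R N g L)
      \<Longrightarrow> f N = f M + f L"
  shows "class_extension f u = 0"
proof -
  let ?R = "{frag_of (iso_class M) - frag_of (iso_class N) + frag_of (iso_class L)
        | M i N g L. short_exact M i N g L \<and> (\<forall>R\<in>X. Hom_surjective R N g L)}"
  have gen: "class_extension f r = 0 \<and> Poly_Mapping.keys r \<subseteq> iso_classes" if "r \<in> ?R" for r
  proof -
    obtain M i N g L where r: "r = frag_of (iso_class M) - frag_of (iso_class N) + frag_of (iso_class L)"
      and ex: "short_exact M i N g L" and surj: "\<And>R. R \<in> X \<Longrightarrow> Hom_surjective R N g L"
      using \<open>r \<in> ?R\<close> by blast
    have m: "is_module M" "is_module N" "is_module L" using ex by (auto simp: short_exact_def)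
    have "r \<in> carrier free_on_classes"
      using m unfolding r by (auto simp: iso_classes_def dest!: keys_diff[THEN subsetD] keys_add[THEN subsetD])
    then show ?thesis
      using additive[OF ex surj] m
      by (simp add: r class_extension_add class_extension_diff class_extension_iso_class inv)
  qed
  from u show ?thesis
    unfolding exact_relations_def
  proof (induction rule: generate.induct)
    case (inv h)
    then show ?case using gen[OF inv] by (simp add: class_extension_uminus)
  next
    case (eng h1 h2)
    then show ?case by (simp add: class_extension_add)
  qed (use gen in \<open>auto simp: class_extension_zero\<close>)
qed

lemma exact_relation_mem:
  assumes "short_exact M f N g L" "\<And>R. R \<in> X \<Longrightarrow> Hom_surjective R N g L"
  shows "frag_of (iso_class M) - frag_of (iso_class N) + frag_of (iso_class L) \<in> exact_relations X"
  unfolding exact_relations_def by (rule generate.incl) (use assms in blast)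

lemma frag_of_iso_class_in_carrier: "is_module M \<Longrightarrow> frag_of (iso_class M) \<in> carrier free_on_classes"
  by (simp add: iso_classes_def)

lemma carrier_diff:
  "u \<in> carrier (free_Abelian_group S) \<Longrightarrow> v \<in> carrier (free_Abelian_group S) \<Longrightarrow>
     u - v \<in> carrier (free_Abelian_group S)"
  using keys_diff[of u v] by auto

lemma carrier_add:
  "u \<in> carrier (free_Abelian_group S) \<Longrightarrow> v \<in> carrier (free_Abelian_group S) \<Longrightarrow>
     u + v \<in> carrier (free_Abelian_group S)"
  using keys_add[of u v] by auto

lemma subgroup_exact_relations: "subgroup (exact_relations X) free_on_classes"
  unfolding exact_relations_def
proof (rule group.generate_is_subgroup[OF group_free_Abelian_group], safe)
  fix M f N g L assume "short_exact M f N g L"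
  then have "is_module M" "is_module N" "is_module L" by (auto simp: short_exact_def)
  then show "frag_of (iso_class M) - frag_of (iso_class N) + frag_of (iso_class L)
      \<in> carrier free_on_classes"
    by (intro carrier_add carrier_diff frag_of_iso_class_in_carrier)
qed

lemma subgroup_split_relations: "subgroup split_relations free_on_classes"
  unfolding split_relations_def
proof (rule group.generate_is_subgroup[OF group_free_Abelian_group], safe)
  fix M N :: "('a, 'b) pmod" assume "is_module M" "is_module N"
  then show "frag_of (iso_class (direct_sum M N)) - (frag_of (iso_class M) + frag_of (iso_class N))
      \<in> carrier free_on_classes"
    by (intro carrier_add carrier_diff frag_of_iso_class_in_carrier is_module_direct_sum)
qed

lemma
  shows exact_relations_zero: "0 \<in> exact_relations X"
    and exact_relations_add: "u \<in> exact_relations X \<Longrightarrow> v \<in> exact_relations X \<Longrightarrow> u + v \<in> exact_relations X"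
    and exact_relations_uminus: "u \<in> exact_relations X \<Longrightarrow> - u \<in> exact_relations X"
    and exact_relations_carrier: "u \<in> exact_relations X \<Longrightarrow> u \<in> carrier free_on_classes"
  using subgroup.one_closed[OF subgroup_exact_relations[of X]]
    subgroup.m_closed[OF subgroup_exact_relations[of X], of u v]
    subgroup.m_inv_closed[OF subgroup_exact_relations[of X], of u]
    subgroup.mem_carrier[OF subgroup_exact_relations[of X], of u]
  by simp_all

lemma exact_relations_diff:
  "u \<in> exact_relations X \<Longrightarrow> v \<in> exact_relations X \<Longrightarrow> u - v \<in> exact_relations X"
  using exact_relations_add[of u X "- v"] exact_relations_uminus[of v X] by simp

lemma direct_sum_split_exact:
  assumes M: "is_module M" and N: "is_module N"
  shows "short_exact M (\<lambda>_ u. vjoin u 0) (direct_sum M N) (\<lambda>_. right_part) N"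
    and "Hom_surjective R (direct_sum M N) (\<lambda>_. right_part) N"
proof -
  have z: "trans_map N a b 0 = 0" "trans_map M a b 0 = 0" if "a \<le> b" for a b
    using linear_map_zero[OF module_linear[OF _ that] module_zero] M N by auto
  have "pmod_hom M (direct_sum M N) (\<lambda>_ u. vjoin u 0)"
    using module_zero[OF N] z
    by (auto simp: pmod_hom_def linear_map_def vspace_direct_sum_iff trans_map_direct_sum vjoin_eq_iff
        left_part_add right_part_add left_part_vscale right_part_vscale KN.scale_zero_right)
  moreover have "pmod_hom (direct_sum M N) N (\<lambda>_. right_part)"
    by (auto simp: pmod_hom_def linear_map_def vspace_direct_sum_iff trans_map_direct_sum
        right_part_add right_part_vscale)
  moreover have "(\<lambda>u. vjoin u 0) ` vspace M a = {v \<in> vspace (direct_sum M N) a. right_part v = 0}" for a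
    using module_zero[OF N]
    by (auto simp: vspace_direct_sum_iff image_iff) (metis vjoin_parts)
  moreover have "right_part ` vspace (direct_sum M N) a = vspace N a" for a
  proof (intro subset_antisym subsetI)
    fix v assume "v \<in> vspace N a"
    then have "vjoin 0 v \<in> vspace (direct_sum M N) a"
      using module_zero[OF M] by (simp add: vspace_direct_sum_iff)
    then show "v \<in> right_part ` vspace (direct_sum M N) a"
      by (rule rev_image_eqI) simp
  qed (auto simp: vspace_direct_sum_iff)
  moreover have "inj_on (\<lambda>u. vjoin u 0) (vspace M a)" for a
    by (auto simp: inj_on_def vjoin_eq_iff)
  ultimately show "short_exact M (\<lambda>_ u. vjoin u 0) (direct_sum M N) (\<lambda>_. right_part) N"
    using M N is_module_direct_sum[OF M N] unfolding short_exact_def by blast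
  show "Hom_surjective R (direct_sum M N) (\<lambda>_. right_part) N"
    unfolding Hom_surjective_def
  proof (intro allI impI)
    fix h assume h: "pmod_hom R N h"
    have "pmod_hom R (direct_sum M N) (\<lambda>x v. vjoin 0 (h x v))"
      using h module_zero[OF M] z
      by (auto simp: pmod_hom_def linear_map_def vspace_direct_sum_iff trans_map_direct_sum vjoin_eq_iff
          left_part_add right_part_add left_part_vscale right_part_vscale KN.scale_zero_right)
    then show "\<exists>h'. pmod_hom R (direct_sum M N) h' \<and> (\<forall>a. \<forall>v\<in>vspace R a. right_part (h' a v) = h a v)"
      by (intro exI[of _ "\<lambda>x v. vjoin 0 (h x v)"]) simp
  qed
qed

lemma direct_sum_exact_relation:
  assumes "is_module M" "is_module N"
  shows "frag_of (iso_class M) - frag_of (iso_class (direct_sum M N)) + frag_of (iso_class N)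
    \<in> exact_relations X"
  by (rule exact_relation_mem) (rule direct_sum_split_exact[OF assms])+

text \<open>Up to sign, a split relation is the relation of the canonical sequence of a direct sum.\<close>
lemma split_relations_subset: "split_relations \<subseteq> exact_relations X"
proof
  fix u :: "('a, 'b) free_elem" assume "u \<in> split_relations"
  then show "u \<in> exact_relations X"
    unfolding split_relations_def
  proof (induction rule: generate.induct)
    case one
    then show ?case by (simp add: exact_relations_zero)
  next
    case (incl h)
    then obtain M N where "is_module M" "is_module N"
      "h = frag_of (iso_class (direct_sum M N)) - (frag_of (iso_class M) + frag_of (iso_class N))"
      by blast
    then have "h = - (frag_of (iso_class M) - frag_of (iso_class (direct_sum M N)) + frag_of (iso_class N))"
      by simp
    then show ?case
      using exact_relations_uminus direct_sum_exact_relation \<open>is_module M\<close> \<open>is_module N\<close> by blast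
  next
    case (inv h)
    then obtain M N where "is_module M" "is_module N"
      "h = frag_of (iso_class (direct_sum M N)) - (frag_of (iso_class M) + frag_of (iso_class N))"
      by blast
    then have "- h = frag_of (iso_class M) - frag_of (iso_class (direct_sum M N)) + frag_of (iso_class N)"
      by simp
    then have "- h \<in> exact_relations X"
      using direct_sum_exact_relation \<open>is_module M\<close> \<open>is_module N\<close> by metis
    moreover from this have "Poly_Mapping.keys h \<subseteq> iso_classes"
      using exact_relations_carrier by fastforce
    ultimately show ?case by simp
  next
    case (eng h1 h2)
    then show ?case by (simp add: exact_relations_add)
  qed
qed

section \<open>The kernels of the two invariants\<close>

text \<open>The kernel of the rank map, taken upstairs in the free abelian group.\<close>
definition rank_null :: "('p::{finite,order}, 'k::field) free_elem \<Rightarrow> bool" where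
  "rank_null u \<longleftrightarrow> (\<forall>a b. a \<le> b \<longrightarrow> class_extension (\<lambda>M. module_rank M a b) u = 0)"

lemma exact_relations_rank_null:
  assumes "u \<in> exact_relations single_source_spread_modules"
  shows "rank_null u"
  unfolding rank_null_def
proof (intro allI impI)
  fix a b :: 'a assume "a \<le> b"
  then show "class_extension (\<lambda>M. module_rank M a b) u = 0"
    by (intro class_extension_vanishes_on_exact_relations[OF assms])
       (auto intro: module_rank_iso module_rank_additive)
qed

lemma mem_r_coset_iff:
  "w \<in> S #>\<^bsub>free_Abelian_group A\<^esub> u \<longleftrightarrow> w - u \<in> S"
proof
  assume "w - u \<in> S"
  then show "w \<in> S #>\<^bsub>free_Abelian_group A\<^esub> u"
    by (auto simp: r_coset_def intro!: bexI[of _ "w - u"])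
qed (auto simp: r_coset_def)

lemma carrier_K0_split:
  "carrier K0_split = (\<lambda>u. split_relations #>\<^bsub>free_on_classes\<^esub> u) ` carrier free_on_classes"
  unfolding K0_split_def by (rule carrier_FactGroup)

lemma split_coset_in_homological_kernel_iff:
  fixes u :: "('p::{finite,order}, 'k::field) free_elem"
  assumes u: "u \<in> carrier free_on_classes"
  shows "split_relations #>\<^bsub>free_on_classes\<^esub> u
      \<in> kernel K0_split (K0_rel single_source_spread_modules) ss_homological_spread_invariant
    \<longleftrightarrow> u \<in> exact_relations single_source_spread_modules"
proof -
  let ?E = "exact_relations single_source_spread_modules :: ('p, 'k) free_elem set"
  let ?U = "split_relations #>\<^bsub>free_on_classes\<^esub> u"
  have "?E #>\<^bsub>free_on_classes\<^esub> w = ?E #>\<^bsub>free_on_classes\<^esub> u" if "w \<in> ?U" for w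
  proof -
    have wu: "w - u \<in> ?E"
      using that split_relations_subset by (auto simp: mem_r_coset_iff)
    have "z - w \<in> ?E \<longleftrightarrow> z - u \<in> ?E" for z
      using exact_relations_add[OF _ wu, of "z - w"] exact_relations_diff[OF _ wu, of "z - u"] by auto
    show ?thesis
    proof (rule Set.set_eqI)
      fix z
      show "z \<in> ?E #>\<^bsub>free_on_classes\<^esub> w \<longleftrightarrow> z \<in> ?E #>\<^bsub>free_on_classes\<^esub> u"
        unfolding mem_r_coset_iff by fact
    qed
  qed
  moreover have "u \<in> ?U"
    using subgroup.one_closed[OF subgroup_split_relations] by (simp add: mem_r_coset_iff)
  ultimately have "(\<lambda>u. ?E #>\<^bsub>free_on_classes\<^esub> u) ` ?U = {?E #>\<^bsub>free_on_classes\<^esub> u}"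
    by blast
  then have "ss_homological_spread_invariant ?U = ?E #>\<^bsub>free_on_classes\<^esub> u"
    unfolding ss_homological_spread_invariant_def induced_def by simp
  moreover have "?E #>\<^bsub>free_on_classes\<^esub> u = ?E \<longleftrightarrow> u \<in> ?E"
  proof
    assume "?E #>\<^bsub>free_on_classes\<^esub> u = ?E"
    moreover have "u \<in> ?E #>\<^bsub>free_on_classes\<^esub> u"
      by (simp add: mem_r_coset_iff exact_relations_zero)
    ultimately show "u \<in> ?E" by simp
  next
    assume uE: "u \<in> ?E"
    have "z - u \<in> ?E \<longleftrightarrow> z \<in> ?E" for z
      using exact_relations_add[OF _ uE, of "z - u"] exact_relations_diff[OF _ uE, of z] by auto
    show "?E #>\<^bsub>free_on_classes\<^esub> u = ?E"
    proof (rule Set.set_eqI)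
      fix z
      show "z \<in> ?E #>\<^bsub>free_on_classes\<^esub> u \<longleftrightarrow> z \<in> ?E"
        unfolding mem_r_coset_iff by fact
    qed
  qed
  moreover have "?U \<in> carrier K0_split" using u by (simp only: carrier_K0_split imageI)
  ultimately show ?thesis
    by (simp add: kernel_def K0_rel_def)
qed

lemma split_coset_in_rank_kernel_iff:
  fixes u :: "('p::{finite,order}, 'k::field) free_elem"
  assumes u: "u \<in> carrier free_on_classes"
  shows "split_relations #>\<^bsub>free_on_classes\<^esub> u \<in> kernel K0_split rank_target rank_invariant
    \<longleftrightarrow> rank_null u"
proof -
  let ?U = "split_relations #>\<^bsub>free_on_classes\<^esub> u"
  have rf: "rank_on_free w = (\<lambda>(a, b)\<in>{(a, b). a \<le> b}. class_extension (\<lambda>M. module_rank M a b) w)"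
    for w :: "('p, 'k) free_elem"
    by (simp add: rank_on_free_def class_extension_def)
  have "rank_on_free w = rank_on_free u" if "w \<in> ?U" for w
  proof -
    have "w - u \<in> exact_relations single_source_spread_modules"
      using that split_relations_subset by (auto simp: mem_r_coset_iff)
    then have "rank_null (w - u)" by (rule exact_relations_rank_null)
    then show ?thesis
      unfolding rf rank_null_def by (intro restrict_ext) (auto simp: class_extension_diff)
  qed
  moreover have "u \<in> ?U"
    using subgroup.one_closed[OF subgroup_split_relations] by (simp add: mem_r_coset_iff)
  ultimately have "rank_on_free ` ?U = {rank_on_free u}" by blast
  then have "rank_invariant ?U = rank_on_free u"
    unfolding rank_invariant_def induced_def by simp
  moreover have "rank_on_free u = \<one>\<^bsub>rank_target\<^esub> \<longleftrightarrow> rank_null u"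
    unfolding rf rank_target_def rank_null_def
    by (auto simp: restrict_def fun_eq_iff integer_group_def)
  moreover have "?U \<in> carrier K0_split" using u by (simp only: carrier_K0_split imageI)
  ultimately show ?thesis
    by (simp add: kernel_def)
qed

text \<open>
  Both kernels consist of cosets of the split relations, and membership in either can be tested on any
  representative, since the split relations are exact and have rank zero. This reduces the comparison
  of kernels in the quotient to a comparison of subgroups of the free group; one of the two inclusions
  always holds.
\<close>
lemma equivalent_iff_rank_null_exact:
  "equivalent (K0_split :: ('p::{finite,order}, 'k::field) K0_elem monoid)
     (K0_rel single_source_spread_modules) ss_homological_spread_invariant
     rank_target rank_invariant
   \<longleftrightarrow> (\<forall>u :: ('p, 'k) free_elem. u \<in> carrier free_on_classes \<longrightarrow> rank_null u \<longrightarrow>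
          u \<in> exact_relations single_source_spread_modules)"
    (is "equivalent ?K _ _ _ _ \<longleftrightarrow> ?R")
proof
  assume "equivalent ?K (K0_rel single_source_spread_modules) ss_homological_spread_invariant
     rank_target rank_invariant"
  then show ?R
    unfolding equivalent_def
    using split_coset_in_homological_kernel_iff split_coset_in_rank_kernel_iff by blast
next
  assume R: ?R
  show "equivalent ?K (K0_rel single_source_spread_modules) ss_homological_spread_invariant
     rank_target rank_invariant"
    unfolding equivalent_def
  proof (rule Set.set_eqI)
    fix U :: "('p, 'k) K0_elem"
    show "U \<in> kernel ?K (K0_rel single_source_spread_modules) ss_homological_spread_invariant
      \<longleftrightarrow> U \<in> kernel ?K rank_target rank_invariant"
    proof (cases "U \<in> carrier ?K")
      case True
      then obtain u where u: "u \<in> carrier free_on_classes"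
        "U = split_relations #>\<^bsub>free_on_classes\<^esub> u"
        unfolding carrier_K0_split by blast
      then show ?thesis
        using R split_coset_in_homological_kernel_iff[OF u(1)] split_coset_in_rank_kernel_iff[OF u(1)]
          exact_relations_rank_null by blast
    qed (simp add: kernel_def)
  qed
qed

lemma homological_invariant_finer_than_rank:
  "finer (K0_split :: ('p::{finite,order}, 'k::field) K0_elem monoid)
     (K0_rel single_source_spread_modules) ss_homological_spread_invariant
     rank_target rank_invariant"
  unfolding finer_def
proof
  fix U :: "('p, 'k) K0_elem"
  assume U: "U \<in> kernel K0_split (K0_rel single_source_spread_modules) ss_homological_spread_invariant"
  then obtain u where u: "u \<in> carrier free_on_classes" "U = split_relations #>\<^bsub>free_on_classes\<^esub> u"
    unfolding kernel_def carrier_K0_split by blast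
  then show "U \<in> kernel K0_split rank_target rank_invariant"
    using U split_coset_in_homological_kernel_iff[OF u(1)] split_coset_in_rank_kernel_iff[OF u(1)]
      exact_relations_rank_null by blast
qed

section \<open>A branching poset separates the invariants\<close>

text \<open>
  The witness is the inclusion-exclusion defect of the intervals \<open>[a,x]\<close> and \<open>[a,y]\<close>. It is detected by
  the functor of the largest spread from \<open>a\<close> that avoids everything above \<open>x\<close> or \<open>y\<close>.
\<close>
lemma rank_null_not_exact_if_branching:
  fixes a x y :: "'p::{finite,order}"
  assumes ax: "a \<le> x" and ay: "a \<le> y" and xy: "\<not> x \<le> y" "\<not> y \<le> x"
  obtains u :: "('p, 'k::field) free_elem"
  where "u \<in> carrier free_on_classes" "rank_null u"
    "u \<notin> exact_relations single_source_spread_modules"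
proof
  let ?I = "\<lambda>D. interval_module D :: ('p, 'k) pmod"
  let ?A = "{a..x}" and ?B = "{a..y}"
  let ?c = "\<lambda>D. frag_of (iso_class (?I D)) :: ('p, 'k) free_elem"
  let ?u = "?c (?A \<union> ?B) + ?c (?A \<inter> ?B) - (?c ?A + ?c ?B)"
  have m: "is_module (?I (?A \<union> ?B))" "is_module (?I (?A \<inter> ?B))" "is_module (?I ?A)" "is_module (?I ?B)"
    by (rule is_module_interval_module; auto intro: order_trans)+
  show "?u \<in> carrier free_on_classes"
    by (intro carrier_add carrier_diff frag_of_iso_class_in_carrier m)
  show "rank_null ?u"
    unfolding rank_null_def
  proof (intro allI impI)
    \<comment> \<open>For \<open>p \<le> q\<close>, a down-closed part of \<open>{a..}\<close> contains both points if and only if \<open>a \<le> p\<close> and it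
      contains \<open>q\<close>, so the four ranks cancel by inclusion-exclusion for the point \<open>q\<close>.\<close>
    fix p q :: 'p assume pq: "p \<le> q"
    have "class_extension (\<lambda>M. module_rank M p q) (?c D) = of_bool (p \<in> D \<and> q \<in> D)"
      if "is_module (?I D)" for D
      by (subst class_extension_iso_class[OF that])
         (use module_rank_iso pq in \<open>auto simp: module_rank_interval_module\<close>)
    note this[OF m(1)] this[OF m(2)] this[OF m(3)] this[OF m(4)]
    then show "class_extension (\<lambda>M. module_rank M p q) ?u = 0"
      using pq by (auto simp: class_extension_add class_extension_diff intro: order_trans)
  qed
  let ?T = "{x..} \<union> {y..}"
  let ?f = "\<lambda>M. KN.dim (annihilated M a ?T)"
  have T: "?T \<subseteq> {a..}" using ax ay by (auto intro: order_trans)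
  have inv: "?f N = ?f M" if "is_module M" "is_module N" "pmod_iso M N" for M N :: "('p, 'k) pmod"
    by (rule annihilated_dim_iso[OF that(3,1,2) T])
  have "class_extension ?f (?c D) = of_bool (a \<in> D \<and> D \<inter> ?T = {})" if "is_module (?I D)" for D
    by (subst class_extension_iso_class[OF that inv]) (simp_all add: dim_annihilated_interval_module)
  note this[OF m(1)] this[OF m(2)] this[OF m(3)] this[OF m(4)]
  moreover have "x \<in> ?A \<inter> ?T" "y \<in> ?B \<inter> ?T" "x \<in> (?A \<union> ?B) \<inter> ?T"
    using ax ay by auto
  moreover have "(?A \<inter> ?B) \<inter> ?T = {}" "a \<in> ?A \<inter> ?B"
    using ax ay xy by (auto dest: order_trans)
  ultimately have "class_extension ?f ?u = 1"
    by (auto simp: class_extension_add class_extension_diff)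
  moreover have "class_extension ?f ?u = 0" if "?u \<in> exact_relations single_source_spread_modules"
  proof (rule class_extension_vanishes_on_exact_relations[OF that inv])
    fix M i N g L
    assume "short_exact M i N g (L :: ('p, 'k) pmod)"
      "\<And>R. R \<in> single_source_spread_modules \<Longrightarrow> Hom_surjective R N g L"
    then show "?f N = ?f M + ?f L"
      by (rule annihilated_dim_additive[OF _ _ T]) (auto intro: order_trans)
  qed
  ultimately show "?u \<notin> exact_relations single_source_spread_modules"
    by auto
qed

section \<open>Splitting one generator off a module\<close>

lemma scaled_unit_in_line: "vscale c line_unit \<in> coord_line"
  by (simp add: coord_line_def line_unit_def vscale_apply)

text \<open>
  The second map of the sequence sends the generator of the spread module to \<open>v\<close> and is the inclusion
  on the submodule \<open>M'\<close>. It is onto because \<open>H\<close> is a complement of \<open>v\<close>, and its kernel is the part of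
  the spread module away from \<open>a\<close>, embedded antidiagonally. A vector at a point other than \<open>a\<close> lifts into
  \<open>M'\<close>. A nonzero vector \<open>w = c v + h\<close> at \<open>a\<close> lifts with the right annihilator because, by the
  assumption \<open>small\<close>, \<open>v\<close> dies wherever \<open>w\<close> does, and hence so does \<open>h\<close>.

  Minimality of \<open>a\<close> in the support (the assumption \<open>below\<close>) makes \<open>M'\<close> a submodule: no structure map
  can enter \<open>M(a)\<close> with a nonzero value.
\<close>
lemma one_generator_exact_relation:
  fixes M :: "('p::{finite,order}, 'k::field) pmod"
  assumes M: "is_module M" and below: "\<And>x. x < a \<Longrightarrow> vspace M x = {0}"
    and ss: "single_source_pair a B"
    and v: "v \<in> vspace M a" "\<And>y. a \<le> y \<Longrightarrow> trans_map M a y v \<noteq> 0 \<longleftrightarrow> y \<in> spread a B"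
    and small: "\<And>y w. a \<le> y \<Longrightarrow> w \<in> vspace M a \<Longrightarrow> w \<noteq> 0 \<Longrightarrow> trans_map M a y w = 0 \<Longrightarrow>
      trans_map M a y v = 0"
    and H: "fd_space H" "H \<subseteq> vspace M a" "v \<notin> H"
      "\<And>w. w \<in> vspace M a \<Longrightarrow> \<exists>c h. h \<in> H \<and> w = vscale c v + h"
  defines "M' \<equiv> M\<lparr>vspace := (vspace M)(a := H)\<rparr>"
    and "S \<equiv> spread_module a B"
  shows "is_module M'"
    and "frag_of (iso_class (interval_module (spread a B - {a})))
        - frag_of (iso_class (direct_sum S M')) + frag_of (iso_class M)
      \<in> exact_relations single_source_spread_modules"
proof -
  let ?D = "spread a B"
  let ?K = "interval_module (?D - {a}) :: ('p, 'k) pmod"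
  have sH: "KN.subspace H" using H(1) by (rule fd_space_subspace)
  have H0: "0 \<in> H" using sH KN.subspace_0 by blast
  have aD: "a \<in> ?D" using ss by (auto simp: spread_def single_source_pair_def)
  have D: "a \<le> x" if "x \<in> ?D" for x using that by (simp add: spread_def)
  have vM': "vspace M' x = (if x = a then H else vspace M x)" for x by (simp add: M'_def)
  have tM': "trans_map M' x y = trans_map M x y" for x y by (simp add: M'_def)
  have M'sub: "vspace M' x \<subseteq> vspace M x" for x using H(2) by (simp add: vM')
  have M'in: "trans_map M x y w \<in> vspace M' y" if xy: "x \<le> y" and w: "w \<in> vspace M' x" for x y w
  proof (cases "y = a")
    case False
    then show ?thesis using module_in[OF M xy] M'sub[of x] w by (auto simp: vM')
  next
    case True
    show ?thesis
    proof (cases "x = a")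
      case True
      then show ?thesis using \<open>y = a\<close> w module_id[OF M] H(2) by (auto simp: vM')
    next
      case False
      then have "x < a" using xy \<open>y = a\<close> by simp
      then have "w = 0" using w below by (simp add: vM' False)
      then show ?thesis
        using linear_map_zero[OF module_linear[OF M xy] module_zero[OF M]] \<open>y = a\<close> H0 by (simp add: vM')
    qed
  qed
  show mM': "is_module M'"
    unfolding is_module_def tM'
  proof (intro conjI allI impI ballI)
    fix x show "fd_space (vspace M' x)" using H(1) module_fd[OF M] by (simp add: vM')
  next
    fix x y :: 'p assume xy: "x \<le> y"
    show "linear_map (vspace M' x) (vspace M' y) (trans_map M x y)"
      unfolding linear_map_def
      using M'in[OF xy] linear_map_add[OF module_linear[OF M xy]]
        linear_map_scale[OF module_linear[OF M xy]] M'sub[of x] by blast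
  next
    fix x w assume "w \<in> vspace M' x"
    then show "trans_map M x x w = w" using module_id[OF M] M'sub by blast
  next
    fix x y z w assume "x \<le> y" "y \<le> z" "w \<in> vspace M' x"
    then show "trans_map M y z (trans_map M x y w) = trans_map M x z w"
      using module_comp[OF M] M'sub by blast
  qed
  have mS: "is_module S" unfolding S_def by (rule is_module_spread_module)
  have mN: "is_module (direct_sum S M')" by (rule is_module_direct_sum[OF mS mM'])
  have mK: "is_module ?K"
    by (rule is_module_interval_module) (auto simp: spread_def intro: order_trans)
  have inN: "w \<in> vspace (direct_sum S M') x \<longleftrightarrow>
      left_part w \<in> (if x \<in> ?D then coord_line else {0}) \<and> right_part w \<in> vspace M' x" for w x
    by (simp add: vspace_direct_sum_iff S_def vspace_spread_module)
  have trN: "trans_map (direct_sum S M') x y w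
      = vjoin (if x \<in> ?D \<and> y \<in> ?D then left_part w else 0) (trans_map M x y (right_part w))" for x y w
    by (simp add: trans_map_direct_sum S_def trans_map_spread_module tM')
  have tv: "trans_map M x y (trans_map M a x v) = trans_map M a y v" if "a \<le> x" "x \<le> y" for x y
    by (rule module_comp[OF M that v(1)])
  have vin: "trans_map M a x v \<in> vspace M x" if "a \<le> x" for x
    by (rule module_in[OF M that v(1)])
  have scale_in: "vscale c u \<in> vspace M x" if "u \<in> vspace M x" for c u x
    using KN.subspace_scale[OF module_subspace[OF M] that] .
  have add_in: "u + u' \<in> vspace M x" if "u \<in> vspace M x" "u' \<in> vspace M x" for u u' x
    using KN.subspace_add[OF module_subspace[OF M] that] .
  have tr0: "trans_map M x y 0 = 0" if "x \<le> y" for x y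
    by (rule linear_map_zero[OF module_linear[OF M that] module_zero[OF M]])
  define g where "g = (\<lambda>x w. vscale (left_part w 0) (trans_map M a x v) + right_part w)"
  define f where "f = (\<lambda>x (s :: nat \<Rightarrow> 'k). vjoin s (vscale (- s 0) (trans_map M a x v)))"
  have gin: "g x w \<in> vspace M x" if "w \<in> vspace (direct_sum S M') x" for x w
  proof (cases "x \<in> ?D")
    case True
    then show ?thesis
      unfolding g_def using that M'sub[of x] by (intro add_in scale_in vin D) (auto simp: inN)
  next
    case False
    then show ?thesis
      unfolding g_def using that M'sub[of x] by (auto simp: inN KN.scale_zero_left)
  qed
  have g: "pmod_hom (direct_sum S M') M g"
    unfolding pmod_hom_def
  proof (intro conjI allI impI ballI)
    fix x
    show "linear_map (vspace (direct_sum S M') x) (vspace M x) (g x)"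
      unfolding linear_map_def
    proof (intro conjI allI ballI)
      fix u w
      show "g x (u + w) = g x u + g x w"
        unfolding g_def left_part_add right_part_add plus_fun_apply KN.scale_left_distrib
        by (simp only: ac_simps)
    next
      fix c w
      show "g x (vscale c w) = vscale c (g x w)"
        unfolding g_def left_part_vscale right_part_vscale KN.scale_right_distrib KN.scale_scale vscale_apply
        by (rule refl)
    qed (rule gin)
  next
    fix x y :: 'p and w assume xy: "x \<le> y" and w: "w \<in> vspace (direct_sum S M') x"
    have r: "right_part w \<in> vspace M x" using w M'sub[of x] by (auto simp: inN)
    show "g y (trans_map (direct_sum S M') x y w) = trans_map M x y (g x w)"
    proof (cases "x \<in> ?D")
      case True
      have ax: "a \<le> x" by (rule D[OF True])
      have "trans_map M x y (g x w)
          = trans_map M x y (vscale (left_part w 0) (trans_map M a x v)) + trans_map M x y (right_part w)"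
        unfolding g_def by (rule linear_map_add[OF module_linear[OF M xy] scale_in[OF vin[OF ax]] r])
      also have "trans_map M x y (vscale (left_part w 0) (trans_map M a x v))
          = vscale (left_part w 0) (trans_map M a y v)"
        unfolding linear_map_scale[OF module_linear[OF M xy] vin[OF ax]] tv[OF ax xy] by (rule refl)
      finally have e: "trans_map M x y (g x w)
          = vscale (left_part w 0) (trans_map M a y v) + trans_map M x y (right_part w)" .
      show ?thesis
      proof (cases "y \<in> ?D")
        case True
        then show ?thesis unfolding e using \<open>x \<in> ?D\<close> by (simp add: g_def trN)
      next
        case False
        then have "trans_map M a y v = 0" using v(2)[of y] ax xy by (meson order_trans)
        then show ?thesis unfolding e using False by (simp add: g_def trN KN.scale_zero_right)
      qed
    next
      case False
      then have "left_part w = 0" using w by (simp add: inN)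
      then show ?thesis by (simp add: g_def trN KN.scale_zero_left False)
    qed
  qed
  have inK: "s \<in> vspace ?K x \<longleftrightarrow> s \<in> (if x \<in> ?D \<and> x \<noteq> a then coord_line else {0})" for s x
    by simp
  have f: "pmod_hom ?K (direct_sum S M') f"
    unfolding pmod_hom_def
  proof (intro conjI allI impI ballI)
    fix x
    show "linear_map (vspace ?K x) (vspace (direct_sum S M') x) (f x)"
      unfolding linear_map_def
    proof (intro conjI allI ballI)
      fix s assume s: "s \<in> vspace ?K x"
      show "f x s \<in> vspace (direct_sum S M') x"
      proof (cases "x \<in> ?D \<and> x \<noteq> a")
        case True
        then show ?thesis
          using s scale_in[OF vin[OF D], of x "- s 0"] by (simp add: inN f_def vM')
      next
        case False
        then have "s = 0" using s by (simp split: if_splits)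
        then show ?thesis
          using module_zero[OF mN, of x] by (simp add: f_def KN.scale_zero_left)
      qed
    next
      fix s t :: "nat \<Rightarrow> 'k"
      show "f x (s + t) = f x s + f x t"
        unfolding f_def vjoin_add[symmetric] KN.scale_left_distrib[symmetric] by simp
    next
      fix c and s :: "nat \<Rightarrow> 'k"
      show "f x (vscale c s) = vscale c (f x s)"
        unfolding f_def vjoin_vscale[symmetric] KN.scale_scale by (simp add: vscale_apply)
    qed
  next
    fix x y :: 'p and s assume xy: "x \<le> y" and s: "s \<in> vspace ?K x"
    show "f y (trans_map ?K x y s) = trans_map (direct_sum S M') x y (f x s)"
    proof (cases "x \<in> ?D \<and> x \<noteq> a")
      case True
      then have ax: "a \<le> x" using D by blast
      then have ya: "y \<noteq> a" using True xy by (meson order_antisym)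
      have t: "trans_map M x y (vscale (- s 0) (trans_map M a x v)) = vscale (- s 0) (trans_map M a y v)"
        unfolding linear_map_scale[OF module_linear[OF M xy] vin[OF ax]] tv[OF ax xy] by (rule refl)
      show ?thesis
      proof (cases "y \<in> ?D")
        case True
        then show ?thesis
          using \<open>x \<in> ?D \<and> x \<noteq> a\<close> ya t by (simp add: f_def trN)
      next
        case False
        then have "trans_map M a y v = 0" using v(2)[of y] ax xy by (meson order_trans)
        then show ?thesis
          using False t by (simp add: f_def trN KN.scale_zero_right)
      qed
    next
      case False
      then have "s = 0" using s by (simp split: if_splits)
      then show ?thesis
        using tr0[OF xy] by (simp add: f_def trN KN.scale_zero_left)
    qed
  qed
  \<comment> \<open>At the source the sum of the line of \<open>v\<close> and \<open>H\<close> is direct, so the kernel vanishes there.\<close>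
  have cancel: "c = 0" if "vscale c v + h = 0" "h \<in> H" for c h
  proof (rule ccontr)
    assume "c \<noteq> 0"
    have "vscale c v = - h" using that(1) by (simp add: eq_neg_iff_add_eq_0)
    then have "vscale c v \<in> H" using that(2) KN.subspace_neg[OF sH] by simp
    then have "vscale (inverse c) (vscale c v) \<in> H" by (rule KN.subspace_scale[OF sH])
    then show False using H(3) \<open>c \<noteq> 0\<close> by (simp add: KN.scale_scale KN.scale_one)
  qed
  have ker: "f x ` vspace ?K x = {w \<in> vspace (direct_sum S M') x. g x w = 0}" for x
  proof (intro subset_antisym subsetI)
    fix w assume "w \<in> f x ` vspace ?K x"
    then obtain s where s: "s \<in> vspace ?K x" "w = f x s" by blast
    have "g x w = vscale (s 0) (trans_map M a x v) + vscale (- s 0) (trans_map M a x v)"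
      using s(2) by (simp add: g_def f_def)
    also have "\<dots> = 0" by (simp add: KN.scale_minus_left)
    finally show "w \<in> {w \<in> vspace (direct_sum S M') x. g x w = 0}"
      using s linear_map_in[OF hom_linear[OF f]] by blast
  next
    fix w assume "w \<in> {w \<in> vspace (direct_sum S M') x. g x w = 0}"
    then have w: "w \<in> vspace (direct_sum S M') x"
      and g0: "vscale (left_part w 0) (trans_map M a x v) + right_part w = 0"
      by (simp_all add: g_def)
    have "right_part w = - vscale (left_part w 0) (trans_map M a x v)"
      using g0 by (simp add: eq_neg_iff_add_eq_0 add.commute)
    then have "w = f x (left_part w)"
      by (simp add: f_def KN.scale_minus_left flip: vjoin_eq_iff)
         (metis vjoin_parts)
    moreover have "left_part w \<in> vspace ?K x"
    proof (cases "x = a")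
      case True
      have "left_part w 0 = 0"
        using cancel[of "left_part w 0" "right_part w"] g0 w module_id[OF M v(1)]
        by (simp add: True inN vM')
      moreover have "left_part w \<in> coord_line" using w aD True by (simp add: inN)
      ultimately have "left_part w = 0"
        using coord_line_eq_scaled_unit[of "left_part w"] by (simp add: KN.scale_zero_left)
      then show ?thesis using True by simp
    next
      case False
      then show ?thesis using w by (simp add: inN)
    qed
    ultimately show "w \<in> f x ` vspace ?K x" by blast
  qed
  have onto: "g x ` vspace (direct_sum S M') x = vspace M x" for x
  proof (intro subset_antisym subsetI)
    fix w assume w: "w \<in> vspace M x"
    show "w \<in> g x ` vspace (direct_sum S M') x"
    proof (cases "x = a")
      case True
      obtain c h where ch: "h \<in> H" "w = vscale c v + h" using H(4) w True by blast
      have "vjoin (vscale c line_unit) h \<in> vspace (direct_sum S M') x"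
        using ch True aD scaled_unit_in_line
        by (simp add: inN vM')
      moreover have "g x (vjoin (vscale c line_unit) h) = w"
        using ch True module_id[OF M v(1)] by (simp add: g_def vscale_apply)
      ultimately show ?thesis by blast
    next
      case False
      have "(0 :: nat \<Rightarrow> 'k) \<in> coord_line" by (simp add: coord_line_def)
      then have "vjoin 0 w \<in> vspace (direct_sum S M') x" using w False by (simp add: inN vM')
      moreover have "g x (vjoin 0 w) = w" by (simp add: g_def KN.scale_zero_left)
      ultimately show ?thesis by (metis imageI)
    qed
  qed (use gin in blast)
  have "inj_on (f x) (vspace ?K x)" for x
    by (rule inj_onI) (metis f_def left_part_vjoin)
  then have ex: "short_exact ?K f (direct_sum S M') g M"
    unfolding short_exact_def using mK mN M f g ker onto by blast
  have surj: "Hom_surjective R (direct_sum S M') g M" if R: "R \<in> single_source_spread_modules"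
    for R :: "('p, 'k) pmod"
  proof -
    obtain x C where xC: "single_source_pair x C" "R = spread_module x C"
      using R by (auto simp: single_source_spread_modules_def)
    let ?T = "{x..} - spread x C"
    have "w \<in> g x ` annihilated (direct_sum S M') x ?T" if w: "w \<in> annihilated M x ?T" for w
    proof -
      have wM: "w \<in> vspace M x" and w0: "\<And>y. y \<in> ?T \<Longrightarrow> trans_map M x y w = 0"
        using w by (auto simp: annihilated_def)
      have l0: "(0 :: nat \<Rightarrow> 'k) \<in> coord_line" by (simp add: coord_line_def)
      show ?thesis
      proof (cases "x = a \<and> w \<noteq> 0")
        case False
        then have "w \<in> vspace M' x" using wM H0 by (auto simp: vM')
        then have "vjoin 0 w \<in> vspace (direct_sum S M') x" using l0 by (simp add: inN)
        moreover have "trans_map (direct_sum S M') x y (vjoin 0 w) = 0" if "y \<in> ?T" for y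
          using w0[OF that] by (simp add: trN)
        ultimately have "vjoin 0 w \<in> annihilated (direct_sum S M') x ?T"
          unfolding annihilated_def by blast
        moreover have "g x (vjoin 0 w) = w" by (simp add: g_def KN.scale_zero_left)
        ultimately show ?thesis by (metis imageI)
      next
        case True
        then have xa: "x = a" and wn: "w \<noteq> 0" by auto
        obtain c h where ch: "h \<in> H" "w = vscale c v + h" using H(4) wM xa by blast
        let ?l = "vjoin (vscale c line_unit) h"
        have "?l \<in> vspace (direct_sum S M') x"
          using ch xa aD scaled_unit_in_line
          by (simp add: inN vM')
        moreover have "trans_map (direct_sum S M') x y ?l = 0" if y: "y \<in> ?T" for y
        proof -
          have ay: "a \<le> y" using y xa by auto
          have vy: "trans_map M a y v = 0"
            using small[OF ay, of w] wM wn w0[OF y] xa by blast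
          then have "y \<notin> ?D" using v(2)[OF ay] by blast
          have "trans_map M a y w = vscale c (trans_map M a y v) + trans_map M a y h"
            unfolding ch(2) linear_map_add[OF module_linear[OF M ay] scale_in[OF v(1)] subsetD[OF H(2) ch(1)]]
              linear_map_scale[OF module_linear[OF M ay] v(1)] by (rule refl)
          then have "trans_map M a y h = 0"
            using w0[OF y] xa vy by (simp add: KN.scale_zero_right)
          then show ?thesis using \<open>y \<notin> ?D\<close> xa by (simp add: trN)
        qed
        ultimately have "?l \<in> annihilated (direct_sum S M') x ?T"
          unfolding annihilated_def by blast
        moreover have "g x ?l = w"
          using ch xa module_id[OF M v(1)] by (simp add: g_def vscale_apply)
        ultimately show ?thesis by blast
      qed
    qed
    then show ?thesis
      unfolding xC(2) Hom_surjective_spread_iff[OF mN M g xC(1)] by blast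
  qed
  show "frag_of (iso_class ?K) - frag_of (iso_class (direct_sum S M')) + frag_of (iso_class M)
      \<in> exact_relations single_source_spread_modules"
    by (rule exact_relation_mem[OF ex surj])
qed

section \<open>Interval modules generate when all principal up-sets are chains\<close>

definition interval_combination :: "('p \<times> 'p \<Rightarrow> int) \<Rightarrow> ('p::{finite,order}, 'k::field) free_elem" where
  "interval_combination n = (\<Sum>p\<in>{(a, b). a \<le> b}.
     frag_cmul (n p) (frag_of (iso_class (spread_module (fst p) {snd p}))))"

text \<open>
  The class in the relative Grothendieck group is an integral combination of classes of interval
  modules.
\<close>
definition interval_spanned :: "('p::{finite,order}, 'k::field) free_elem \<Rightarrow> bool" where
  "interval_spanned u \<longleftrightarrow>
     (\<exists>n. u - interval_combination n \<in> exact_relations single_source_spread_modules)"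

lemma interval_combination_diff:
  "interval_combination (\<lambda>p. m p - n p) = interval_combination m - interval_combination n"
  by (simp add: interval_combination_def sum_subtractf frag_cmul_diff_distrib)

lemma interval_combination_zero: "interval_combination (\<lambda>_. 0) = 0"
  by (simp add: interval_combination_def)

lemma interval_spanned_diff:
  assumes "interval_spanned u" "interval_spanned v"
  shows "interval_spanned (u - v)"
proof -
  obtain m n where
    "u - interval_combination m \<in> exact_relations single_source_spread_modules"
    "v - interval_combination n \<in> exact_relations single_source_spread_modules"
    using assms by (auto simp: interval_spanned_def)
  then have "(u - interval_combination m) - (v - interval_combination n)
      \<in> exact_relations single_source_spread_modules"
    by (rule exact_relations_diff)
  then have "(u - v) - interval_combination (\<lambda>p. m p - n p)
      \<in> exact_relations single_source_spread_modules"
    by (simp add: interval_combination_diff algebra_simps)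
  then show ?thesis unfolding interval_spanned_def by blast
qed

lemma exact_relations_interval_spanned:
  assumes "u \<in> exact_relations single_source_spread_modules"
  shows "interval_spanned u"
  unfolding interval_spanned_def
  by (rule exI[of _ "\<lambda>_. 0"]) (simp add: interval_combination_zero assms)

lemma interval_spanned_add:
  assumes "interval_spanned u" "interval_spanned v"
  shows "interval_spanned (u + v)"
  using interval_spanned_diff[OF assms(1)
      interval_spanned_diff[OF exact_relations_interval_spanned[OF exact_relations_zero] assms(2)]]
  by simp

lemma interval_spanned_interval:
  fixes a b :: "'p::{finite,order}"
  assumes "a \<le> b"
  shows "interval_spanned (frag_of (iso_class (spread_module a {b} :: ('p, 'k::field) pmod)))"
proof -
  let ?g = "\<lambda>p. frag_of (iso_class (spread_module (fst p) {snd p})) :: ('p, 'k) free_elem"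
  have "interval_combination (\<lambda>p. if p = (a, b) then 1 else 0)
      = (\<Sum>p\<in>{(a, b). a \<le> b}. if p = (a, b) then ?g p else 0)"
    unfolding interval_combination_def by (rule sum.cong) auto
  also have "\<dots> = ?g (a, b)" using assms by (simp add: sum.delta)
  finally have "?g (a, b) - interval_combination (\<lambda>p. if p = (a, b) then 1 else 0) = 0" by simp
  then show ?thesis
    unfolding interval_spanned_def using exact_relations_zero by (metis fst_conv snd_conv)
qed

text \<open>For a zero module \<open>M\<close>, the sequence with all three terms equal to \<open>M\<close> is exact.\<close>
lemma zero_module_exact_relation:
  assumes M: "is_module M" and z: "\<And>x. vspace M x = {0}"
  shows "frag_of (iso_class M) \<in> exact_relations X"
proof -
  have id: "pmod_hom M M (\<lambda>_ v. v)" by (auto simp: pmod_hom_def linear_map_def)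
  have "short_exact M (\<lambda>_ v. v) M (\<lambda>_ v. v) M"
    using M id z by (auto simp: short_exact_def)
  moreover have "Hom_surjective R M (\<lambda>_ v. v) M" for R
    by (auto simp: Hom_surjective_def)
  ultimately have "frag_of (iso_class M) - frag_of (iso_class M) + frag_of (iso_class M)
      \<in> exact_relations X"
    by (rule exact_relation_mem)
  then show ?thesis by simp
qed

context
  assumes chains: "\<And>a x y :: 'p::{finite,order}. a \<le> x \<Longrightarrow> a \<le> y \<Longrightarrow> x \<le> y \<or> y \<le> x"
begin

lemma single_source_pair_singleton:
  assumes "single_source_pair (a :: 'p) B"
  obtains b where "B = {b}" "a \<le> b"
proof -
  obtain b where b: "b \<in> B" "a \<le> b" using assms by (auto simp: single_source_pair_def)
  moreover have "b' = b" if "b' \<in> B" for b'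
    using assms that b chains[of a b b'] unfolding single_source_pair_def by blast
  ultimately show ?thesis using that by blast
qed

text \<open>
  In a chain the half-open interval \<open>(a,b]\<close> is empty or starts at the successor of \<open>a\<close>. Without the
  chain condition it could have several minimal elements.
\<close>
lemma interval_spanned_truncated_interval:
  assumes ab: "(a :: 'p) \<le> b"
  shows "interval_spanned (frag_of (iso_class
    (interval_module (spread a {b} - {a}) :: ('p, 'k::field) pmod)))"
proof (cases "a = b")
  case True
  then have e: "spread a {b} - {a} = {}" by (auto simp: spread_def)
  have "is_module (interval_module {} :: ('p, 'k) pmod)"
    by (rule is_module_interval_module) auto
  then show ?thesis
    unfolding e by (intro exact_relations_interval_spanned zero_module_exact_relation) auto
next
  case False
  then have "{a<..b} \<noteq> {}" using ab by auto
  then obtain c where c: "c \<in> {a<..b}" "\<And>y. y \<in> {a<..b} \<Longrightarrow> y \<le> c \<Longrightarrow> c = y"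
    using finite_has_minimal[of "{a<..b}"] by (metis finite)
  have "c \<le> y" if "y \<in> {a<..b}" for y
    using chains[of a c y] c(2)[OF that] c(1) that by (auto simp: less_le)
  then have "spread a {b} - {a} = spread c {b}"
    using c(1) by (auto simp: spread_def less_le)
  then show ?thesis
    using interval_spanned_interval[of c b] c(1) by (simp add: spread_module_eq_interval_module)
qed

text \<open>
  The induction is on the total dimension. Of the three modules into which the one-generator sequence
  decomposes \<open>M\<close>, two are (possibly empty) intervals and need no induction hypothesis; the third is a
  proper submodule.
\<close>
lemma interval_spanned_module:
  fixes M :: "('p, 'k::field) pmod"
  assumes "is_module M"
  shows "interval_spanned (frag_of (iso_class M))"
  using assms
proof (induction "\<Sum>x\<in>UNIV. KN.dim (vspace M x)" arbitrary: M rule: less_induct)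
  case less
  note M = \<open>is_module M\<close>
  show ?case
  proof (cases "\<forall>x. vspace M x = {0}")
    case True
    then show ?thesis
      using exact_relations_interval_spanned zero_module_exact_relation[OF M] by blast
  next
    case False
    then have "{x. vspace M x \<noteq> {0}} \<noteq> {}" by blast
    then obtain a where a: "vspace M a \<noteq> {0}" "\<And>x. vspace M x \<noteq> {0} \<Longrightarrow> x \<le> a \<Longrightarrow> a = x"
      using finite_has_minimal[of "{x. vspace M x \<noteq> {0}}"] by auto
    have below: "vspace M x = {0}" if "x < a" for x
      using a(2)[of x] that less_le by blast
    obtain v where v: "v \<in> vspace M a" "v \<noteq> 0"
      and small: "\<And>y w. a \<le> y \<Longrightarrow> w \<in> vspace M a \<Longrightarrow> w \<noteq> 0 \<Longrightarrow> trans_map M a y w = 0 \<Longrightarrow>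
        trans_map M a y v = 0"
    proof -
      let ?Y = "{y. a \<le> y \<and> (\<exists>w\<in>vspace M a. w \<noteq> 0 \<and> trans_map M a y w = 0)}"
      show ?thesis
      proof (cases "?Y = {}")
        case True
        obtain v where "v \<in> vspace M a" "v \<noteq> 0"
          using a(1) module_zero[OF M] by blast
        then show ?thesis using that[of v] True by blast
      next
        case False
        \<comment> \<open>The kernels grow along the chain above \<open>a\<close>, so any nonzero vector of the first nonzero one
          lies in all the others.\<close>
        obtain c where c: "c \<in> ?Y" "\<forall>y\<in>?Y. y \<le> c \<longrightarrow> c = y"
          using finite_has_minimal[OF finite False] by blast
        from c(1) obtain v where v: "v \<in> vspace M a" "v \<noteq> 0" "trans_map M a c v = 0" and ac: "a \<le> c"
          by blast
        have "trans_map M a y v = 0" if "y \<in> ?Y" for y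
        proof -
          have "a \<le> y" using that by blast
          then have cy: "c \<le> y" using chains[OF ac] c(2) that by blast
          then have "trans_map M a y v = trans_map M c y 0"
            using module_comp[OF M ac cy v(1)] v(3) by simp
          then show ?thesis
            using linear_map_zero[OF module_linear[OF M cy] module_zero[OF M]] by simp
        qed
        then show ?thesis using that[of v] v by blast
      qed
    qed
    obtain B where B: "single_source_pair a B" "spread a B = {y. a \<le> y \<and> trans_map M a y v \<noteq> 0}"
    proof (rule spread_of_down_set[of a "{y. a \<le> y \<and> trans_map M a y v \<noteq> 0}"])
      show "a \<in> {y. a \<le> y \<and> trans_map M a y v \<noteq> 0}"
        using v module_id[OF M v(1)] by simp
    next
      fix x y assume y: "y \<in> {y. a \<le> y \<and> trans_map M a y v \<noteq> 0}" and ax: "a \<le> x" and xy: "x \<le> y"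
      then show "x \<in> {y. a \<le> y \<and> trans_map M a y v \<noteq> 0}"
        using module_comp[OF M ax xy v(1)] linear_map_zero[OF module_linear[OF M xy] module_zero[OF M]]
        by auto
    qed auto
    obtain b where b: "B = {b}" "a \<le> b" by (rule single_source_pair_singleton[OF B(1)])
    obtain H where H: "fd_space H" "H \<subseteq> vspace M a" "v \<notin> H" "KN.dim H < KN.dim (vspace M a)"
      "\<forall>w\<in>vspace M a. \<exists>c h. h \<in> H \<and> w = vscale c v + h"
      by (rule fd_space_complement_of_vector[OF module_fd[OF M] v])
    let ?M' = "M\<lparr>vspace := (vspace M)(a := H)\<rparr>"
    let ?S = "spread_module a B :: ('p, 'k) pmod"
    let ?K = "interval_module (spread a B - {a}) :: ('p, 'k) pmod"
    have vB: "trans_map M a y v \<noteq> 0 \<longleftrightarrow> y \<in> spread a B" if "a \<le> y" for y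
      using that B(2) by simp
    note seq = one_generator_exact_relation[OF M below B(1) v(1) vB small H(1-3) H(5)[rule_format]]
    have M': "is_module ?M'" by (rule seq(1))
    have "(\<Sum>x\<in>UNIV. KN.dim (vspace ?M' x)) < (\<Sum>x\<in>UNIV. KN.dim (vspace M x))"
      by (rule sum_strict_mono_ex1) (use H(4) in \<open>auto intro!: exI[of _ a]\<close>)
    then have sM': "interval_spanned (frag_of (iso_class ?M'))"
      using less(1) M' by blast
    have sS: "interval_spanned (frag_of (iso_class ?S))"
      unfolding b(1) by (rule interval_spanned_interval[OF b(2)])
    have sK: "interval_spanned (frag_of (iso_class ?K))"
      unfolding b(1) by (rule interval_spanned_truncated_interval[OF b(2)])
    let ?c = "\<lambda>M. frag_of (iso_class M) :: ('p, 'k) free_elem"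
    have "interval_spanned (?c ?K - ?c (direct_sum ?S ?M') + ?c M)"
      by (rule exact_relations_interval_spanned[OF seq(2)])
    moreover have "interval_spanned (?c ?S - ?c (direct_sum ?S ?M') + ?c ?M')"
      by (rule exact_relations_interval_spanned[OF
            direct_sum_exact_relation[OF is_module_spread_module M']])
    ultimately have "interval_spanned ((?c ?K - ?c (direct_sum ?S ?M') + ?c M)
        - (?c ?S - ?c (direct_sum ?S ?M') + ?c ?M'))"
      by (rule interval_spanned_diff)
    moreover have "interval_spanned (?c ?S + ?c ?M' - ?c ?K)"
      by (rule interval_spanned_diff[OF interval_spanned_add[OF sS sM'] sK])
    ultimately have "interval_spanned ((?c ?K - ?c (direct_sum ?S ?M') + ?c M)
        - (?c ?S - ?c (direct_sum ?S ?M') + ?c ?M') + (?c ?S + ?c ?M' - ?c ?K))"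
      by (rule interval_spanned_add)
    then show ?thesis by simp
  qed
qed

end

text \<open>
  The \<open>(x,y)\<close> sum runs over the intervals that contain \<open>[x,y]\<close>. All of them other than \<open>[x,y]\<close> itself
  have a smaller lower set of the left end or a smaller upper set of the right end, which is why the sum
  of these two cardinalities works as a measure.
\<close>
lemma incidence_sums_zero_imp_zero:
  fixes n :: "'p::{finite,order} \<times> 'p \<Rightarrow> int"
  assumes sums: "\<And>x y. x \<le> y \<Longrightarrow>
      (\<Sum>p\<in>{(a, b). a \<le> b}. n p * of_bool (fst p \<le> x \<and> y \<le> snd p)) = 0"
    and "x \<le> y"
  shows "n (x, y) = 0"
  using assms(2)
proof (induction "card {..x} + card {y..}" arbitrary: x y rule: less_induct)
  case less
  have other: "n p * of_bool (fst p \<le> x \<and> y \<le> snd p) = 0"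
    if "p \<in> {(a, b). a \<le> b}" "p \<noteq> (x, y)" for p
  proof (cases "fst p \<le> x \<and> y \<le> snd p")
    case True
    have "card {..fst p} \<le> card {..x}" "card {snd p..} \<le> card {y..}"
      using True by (auto intro!: card_mono)
    moreover have "fst p < x \<or> y < snd p"
      using True that(2) by (cases p) auto
    then have "card {..fst p} < card {..x} \<or> card {snd p..} < card {y..}"
    proof
      assume "fst p < x"
      then have "{..fst p} \<subset> {..x}" by auto
      then show ?thesis by (simp add: psubset_card_mono)
    next
      assume "y < snd p"
      then have "{snd p..} \<subset> {y..}" by auto
      then show ?thesis by (simp add: psubset_card_mono)
    qed
    ultimately have "n (fst p, snd p) = 0"
      using that(1) by (intro less(1)) auto
    then show ?thesis by simp
  qed auto
  have "0 = (\<Sum>p\<in>{(a, b). a \<le> b}. n p * of_bool (fst p \<le> x \<and> y \<le> snd p))"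
    using sums[OF less(2)] by simp
  also have "\<dots> = (\<Sum>p\<in>{(x, y)}. n p * of_bool (fst p \<le> x \<and> y \<le> snd p))"
    by (rule sum.mono_neutral_right) (use less(2) other in auto)
  also have "\<dots> = n (x, y)" by simp
  finally show ?case by simp
qed

lemma rank_of_interval_combination:
  assumes "x \<le> y"
  shows "class_extension (\<lambda>M. module_rank M x y)
      (interval_combination n :: ('p::{finite,order}, 'k::field) free_elem)
    = (\<Sum>p\<in>{(a, b). a \<le> b}. n p * of_bool (fst p \<le> x \<and> y \<le> snd p))"
proof -
  have "class_extension (\<lambda>M. module_rank M x y)
      (frag_of (iso_class (spread_module a {b} :: ('p, 'k) pmod))) = of_bool (a \<le> x \<and> y \<le> b)" for a b
  proof -
    have "module_rank (spread_module a {b} :: ('p, 'k) pmod) x y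
        = of_bool (x \<in> spread a {b} \<and> y \<in> spread a {b})"
      unfolding spread_module_eq_interval_module by (rule module_rank_interval_module)
    also have "x \<in> spread a {b} \<and> y \<in> spread a {b} \<longleftrightarrow> a \<le> x \<and> y \<le> b"
      using assms by (auto simp: spread_def intro: order_trans)
    finally have r: "module_rank (spread_module a {b} :: ('p, 'k) pmod) x y = of_bool (a \<le> x \<and> y \<le> b)" .
    show ?thesis
      by (subst class_extension_iso_class[OF is_module_spread_module])
         (use module_rank_iso assms r in auto)
  qed
  then show ?thesis
    by (simp add: interval_combination_def class_extension_sum class_extension_frag_cmul)
qed

lemma rank_null_exact_if_chains:
  fixes u :: "('p::{finite,order}, 'k::field) free_elem"
  assumes chains: "\<And>a x y :: 'p. a \<le> x \<Longrightarrow> a \<le> y \<Longrightarrow> x \<le> y \<or> y \<le> x"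
    and u: "u \<in> carrier free_on_classes" and null: "rank_null u"
  shows "u \<in> exact_relations single_source_spread_modules"
proof -
  have "Poly_Mapping.keys u \<subseteq> iso_classes" using u by simp
  then have "interval_spanned u"
  proof (induction rule: frag_induction)
    case zero
    show ?case by (rule exact_relations_interval_spanned[OF exact_relations_zero])
  next
    case (one C)
    then show ?case using interval_spanned_module[OF chains] by (auto simp: iso_classes_def)
  next
    case (diff v w)
    then show ?case by (rule interval_spanned_diff)
  qed
  then obtain n where n: "u - interval_combination n \<in> exact_relations single_source_spread_modules"
    by (auto simp: interval_spanned_def)
  have "(\<Sum>p\<in>{(a, b). a \<le> b}. n p * of_bool (fst p \<le> x \<and> y \<le> snd p)) = 0" if "x \<le> y" for x y
    using exact_relations_rank_null[OF n] null that
    by (simp add: rank_null_def class_extension_diff rank_of_interval_combination)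
  then have "n (x, y) = 0" if "x \<le> y" for x y
    using incidence_sums_zero_imp_zero that by blast
  then have "interval_combination n = (0 :: ('p, 'k) free_elem)"
    unfolding interval_combination_def by (intro sum.neutral) auto
  then show ?thesis using n by simp
qed

section \<open>The comparison theorem\<close>

theorem theorem1p3:
  shows
    "finer (K0_split :: ('p::{finite,order}, 'k::field) K0_elem monoid)
       (K0_rel single_source_spread_modules) ss_homological_spread_invariant
       rank_target rank_invariant
     \<and>
     (equivalent (K0_split :: ('p, 'k) K0_elem monoid)
       (K0_rel single_source_spread_modules) ss_homological_spread_invariant
       rank_target rank_invariant
      \<longleftrightarrow> (\<forall>a::'p. Complete_Partial_Order.chain (\<le>) {x. a \<le> x}))"
proof (rule conjI[OF homological_invariant_finer_than_rank])
  have "(\<forall>u :: ('p, 'k) free_elem. u \<in> carrier free_on_classes \<longrightarrow> rank_null u \<longrightarrow>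
          u \<in> exact_relations single_source_spread_modules)
      \<longleftrightarrow> (\<forall>a x y :: 'p. a \<le> x \<longrightarrow> a \<le> y \<longrightarrow> x \<le> y \<or> y \<le> x)"
  proof
    assume exact: "\<forall>u :: ('p, 'k) free_elem. u \<in> carrier free_on_classes \<longrightarrow> rank_null u \<longrightarrow>
          u \<in> exact_relations single_source_spread_modules"
    show "\<forall>a x y :: 'p. a \<le> x \<longrightarrow> a \<le> y \<longrightarrow> x \<le> y \<or> y \<le> x"
    proof (intro allI impI, rule ccontr)
      fix a x y :: 'p assume "a \<le> x" "a \<le> y" "\<not> (x \<le> y \<or> y \<le> x)"
      then obtain u :: "('p, 'k) free_elem" where "u \<in> carrier free_on_classes" "rank_null u"
        "u \<notin> exact_relations single_source_spread_modules"
        using rank_null_not_exact_if_branching[of a x y] by blast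
      then show False using exact by blast
    qed
  next
    assume "\<forall>a x y :: 'p. a \<le> x \<longrightarrow> a \<le> y \<longrightarrow> x \<le> y \<or> y \<le> x"
    then show "\<forall>u :: ('p, 'k) free_elem. u \<in> carrier free_on_classes \<longrightarrow> rank_null u \<longrightarrow>
          u \<in> exact_relations single_source_spread_modules"
      using rank_null_exact_if_chains by blast
  qed
  then show "equivalent (K0_split :: ('p, 'k) K0_elem monoid)
       (K0_rel single_source_spread_modules) ss_homological_spread_invariant
       rank_target rank_invariant
      \<longleftrightarrow> (\<forall>a::'p. Complete_Partial_Order.chain (\<le>) {x. a \<le> x})"
    unfolding equivalent_iff_rank_null_exact Complete_Partial_Order.chain_def by blast
qed

end
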